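(* The average cost value functions satisfy $$\lim_{n\to\infty}|V_n^*-V^*|=0,$$ where $V_n^*$ (for each $n\ge1$) and $V^*$ are both constants (i.e. they do not depend on the initial state).
   Context: Setting. $\mathsf{Z}$ (state space) and $\mathsf{A}$ (action space) are Borel spaces (Borel subsets of complete separable metric spaces); $d_{\mathsf{A}}$ is the metric on $\mathsf{A}$. $\eta(\cdot|z,a)$ is a stochastic kernel on $\mathsf{Z}$ given $\mathsf{Z}\times\mathsf{A}$ (the transition probability) and $c:\mathsf{Z}\times\mathsf{A}\to[0,\infty)$ is a measurable one-stage cost. Every action in $\mathsf{A}$ is admissible in every state. $\mathbb{F}$ is the set of all measurable functions $f:\mathsf{Z}\to\mathsf{A}$. For a probability measure $\vartheta$ and a measurable function $h$ on $\mathsf{Z}$, $\vartheta(h):=\int_{\mathsf{Z}}h\,d\vartheta$. Policies and cost. Let $\mathsf{H}_0=\mathsf{Z}$ and $\mathsf{H}_t=(\mathsf{Z}\times\mathsf{A})^t\times\mathsf{Z}$ for $t\ge1$. A policy is a sequence $\varphi=\{\varphi_t\}_{t\ge0}$ of stochastic kernels $\varphi_t$ on $\mathsf{A}$ given $\mathsf{H}_t$; $\Phi$ is the set of all policies. A policy $\varphi$ and an initial state $z$ determine (Ionescu Tulcea) a probability measure on $(\mathsf{Z}\times\mathsf{A})^\infty$, with expectation $E_z^\varphi$, under which $z_0=z$, $a_t\sim\varphi_t(\cdot|z_0,a_0,\dots,z_t)$ and $z_{t+1}\sim\eta(\cdot|z_t,a_t)$. The average cost is $V(\varphi,z)=\limsup_{T\to\infty}\frac1T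 E_z^\varphi\big[\sum_{t=0}^{T-1}c(z_t,a_t)\big]$ and the average cost value function is $V^*(z)=\inf_{\varphi\in\Phi}V(\varphi,z)$. Standing assumptions. (a) $c$ is nonnegative and continuous. (b) $\eta$ is weakly continuous: if $(z_k,a_k)\to(z,a)$ then $\eta(\cdot|z_k,a_k)\to\eta(\cdot|z,a)$ weakly. (c) $\mathsf{A}$ is compact. (d) There exist a real number $M\ge0$ and a continuous function $w:\mathsf{Z}\to[1,\infty)$ such that $\sup_{a\in\mathsf{A}}c(z,a)\le Mw(z)$ for each $z\in\mathsf{Z}$, and $\int_{\mathsf{Z}}w(y)\,\eta(dy|z,a)$ is continuous in $(z,a)$. Moreover, there exist a probability measure $\lambda$ on $\mathsf{Z}$ and a continuous function $\phi:\mathsf{Z}\times\mathsf{A}\to[0,\infty)$ such that: (e) $\int_{\mathsf{Z}}w(y)\,\eta(dy|z,a)\le\alpha w(z)+\lambda(w)\phi(z,a)$ for all $(z,a)\in\mathsf{Z}\times\mathsf{A}$, where $\alpha\in(0,1)$; (f) $\eta(D|z,a)\ge\lambda(D)\phi(z,a)$ for all $(z,a)\in\mathsf{Z}\times\mathsf{A}$ and all Borel $D\subset\mathsf{Z}$; (g) $w$ is $\lambda$-integrable; (h) $\int_{\mathsf{Z}}\phi(z,f(z))\,\lambda(dz)>0$ for all $f\in\mathbb{F}$. Quantized model. For each $n\ge1$ a finite set $\Lambda_n=\{a_{n,1},\dots,a_{n,k_n}\}\subset\mathsf{A}$ is fixed with $\min_{i}d_{\mathsf{A}}(a,a_{n,i})<1/n$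 for all $a\in\mathsf{A}$. MDP$_n$ is the Markov decision process with state space $\mathsf{Z}$, action space $\Lambda_n$, transition probability $\eta$ and cost $c$ (both restricted to $\mathsf{Z}\times\Lambda_n$), and $V_n^*$ is its average cost value function (the infimum of the average cost over all policies of MDP$_n$). *)

theory Defs
  imports "HOL-Probability.Probability"
begin

(* The Borel space carried by a Borel subset S of a Polish space. *)
abbreviation borel_on :: "'x::topological_space set \<Rightarrow> 'x measure" where
  "borel_on S \<equiv> restrict_space borel S"

(* A history (z_0,a_0,...,z_(t-1),a_(t-1),z_t) is a pair (h, z_t) with
   h i = (z_i,a_i) for i < t. A stochastic kernel on Y given X is a measurable map
   from X into prob_algebra Y. *)
definition history_space ::
  "'z::topological_space set \<Rightarrow> 'a::topological_space set \<Rightarrow> nat \<Rightarrow> ((nat \<Rightarrow> 'z \<times> 'a) \<times> 'z) measure" where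
  "history_space Z A t = PiM {0..<t} (\<lambda>_. borel_on Z \<Otimes>\<^sub>M borel_on A) \<Otimes>\<^sub>M borel_on Z"

definition policies ::
  "'z::topological_space set \<Rightarrow> 'a::topological_space set
    \<Rightarrow> (nat \<Rightarrow> (nat \<Rightarrow> 'z \<times> 'a) \<times> 'z \<Rightarrow> 'a measure) set" where
  "policies Z A = {\<pi>. \<forall>t. \<pi> t \<in> history_space Z A t \<rightarrow>\<^sub>M prob_algebra (borel_on A)}"

(* Conditional law of (z_t,a_t) given the first t state-action pairs h. *)
definition step_kernel ::
  "'z::topological_space set \<Rightarrow> 'a::topological_space set \<Rightarrow> ('z \<times> 'a \<Rightarrow> 'z measure)
    \<Rightarrow> (nat \<Rightarrow> (nat \<Rightarrow> 'z \<times> 'a) \<times> 'z \<Rightarrow> 'a measure) \<Rightarrow> 'z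
    \<Rightarrow> nat \<Rightarrow> (nat \<Rightarrow> 'z \<times> 'a) \<Rightarrow> ('z \<times> 'a) measure" where
  "step_kernel Z A \<eta> \<pi> z t h =
     (if t = 0 then return (borel_on Z) z else \<eta> (h (t - 1))) \<bind>
       (\<lambda>y. \<pi> t (h, y) \<bind> (\<lambda>a. return (borel_on Z \<Otimes>\<^sub>M borel_on A) (y, a)))"

(* Guarantees that the projective limit in trajectory_measure exists. *)
lemma Ionescu_Tulcea_step_kernel:
  assumes \<eta>[measurable]: "\<eta> \<in> borel_on Z \<Otimes>\<^sub>M borel_on A \<rightarrow>\<^sub>M prob_algebra (borel_on Z)"
    and \<pi>: "\<pi> \<in> policies Z A" and z: "z \<in> Z"
  shows "Ionescu_Tulcea (step_kernel Z A \<eta> \<pi> z) (\<lambda>_. borel_on Z \<Otimes>\<^sub>M borel_on A)"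
proof -
  let ?H = "\<lambda>t. PiM {0..<t} (\<lambda>_::nat. borel_on Z \<Otimes>\<^sub>M borel_on A)"
  have [measurable]: "\<pi> t \<in> ?H t \<Otimes>\<^sub>M borel_on Z \<rightarrow>\<^sub>M prob_algebra (borel_on A)" for t
    using \<pi> by (auto simp: policies_def history_space_def)
  have z': "return (borel_on Z) z \<in> space (prob_algebra (borel_on Z))"
    using z by (simp add: space_prob_algebra prob_space_return space_restrict_space)
  have *: "step_kernel Z A \<eta> \<pi> z t \<in> ?H t \<rightarrow>\<^sub>M prob_algebra (borel_on Z \<Otimes>\<^sub>M borel_on A)" for t
  proof -
    have [measurable]: "(\<lambda>h. if t = 0 then return (borel_on Z) z else \<eta> (h (t - 1)))
        \<in> ?H t \<rightarrow>\<^sub>M prob_algebra (borel_on Z)"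
    proof (cases "t = 0")
      case True
      then show ?thesis using z' by simp
    next
      case False
      then have "t - 1 \<in> {0..<t}" by simp
      then have [measurable]: "(\<lambda>h. h (t - 1)) \<in> ?H t \<rightarrow>\<^sub>M borel_on Z \<Otimes>\<^sub>M borel_on A"
        by (rule measurable_component_singleton)
      show ?thesis using False by simp
    qed
    show ?thesis
      unfolding step_kernel_def by measurable
  qed
  show ?thesis
    using measurable_prob_algebraD[OF *] measurable_space[OF *]
    by (intro Ionescu_Tulcea.intro) (auto simp: space_prob_algebra)
qed

(* The Ionescu Tulcea measure on (Z x A)^infinity. *)
definition trajectory_measure ::
  "'z::topological_space set \<Rightarrow> 'a::topological_space set \<Rightarrow> ('z \<times> 'a \<Rightarrow> 'z measure)
    \<Rightarrow> (nat \<Rightarrow> (nat \<Rightarrow> 'z \<times> 'a) \<times> 'z \<Rightarrow> 'a measure) \<Rightarrow> 'z \<Rightarrow> (nat \<Rightarrow> 'z \<times> 'a) measure" where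
  "trajectory_measure Z A \<eta> \<pi> z =
     projective_family.lim UNIV
       (Ionescu_Tulcea.CI (step_kernel Z A \<eta> \<pi> z) (\<lambda>_. borel_on Z \<Otimes>\<^sub>M borel_on A))
       (\<lambda>_. borel_on Z \<Otimes>\<^sub>M borel_on A)"

(* Costs are nonnegative, so expectations are taken in ennreal and V may a priori be infinite. *)
definition average_cost ::
  "'z::topological_space set \<Rightarrow> 'a::topological_space set \<Rightarrow> ('z \<times> 'a \<Rightarrow> 'z measure)
    \<Rightarrow> ('z \<times> 'a \<Rightarrow> real) \<Rightarrow> (nat \<Rightarrow> (nat \<Rightarrow> 'z \<times> 'a) \<times> 'z \<Rightarrow> 'a measure) \<Rightarrow> 'z \<Rightarrow> ennreal" where
  "average_cost Z A \<eta> c \<pi> z =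
     limsup (\<lambda>T. (\<integral>\<^sup>+\<omega>. (\<Sum>t<T. ennreal (c (\<omega> t))) \<partial>trajectory_measure Z A \<eta> \<pi> z) / of_nat T)"

definition average_cost_value ::
  "'z::topological_space set \<Rightarrow> 'a::topological_space set \<Rightarrow> ('z \<times> 'a \<Rightarrow> 'z measure)
    \<Rightarrow> ('z \<times> 'a \<Rightarrow> real) \<Rightarrow> 'z \<Rightarrow> ennreal" where
  "average_cost_value Z A \<eta> c z = (INF \<pi>\<in>policies Z A. average_cost Z A \<eta> c \<pi> z)"

(* Library weak convergence (weak_conv_m) covers only measures on the reals. *)
definition weakly_converges_on ::
  "'x::topological_space set \<Rightarrow> (nat \<Rightarrow> 'x measure) \<Rightarrow> 'x measure \<Rightarrow> bool" where
  "weakly_converges_on S \<mu> \<nu> \<longleftrightarrow>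
     (\<forall>g::'x \<Rightarrow> real. continuous_on S g \<and> bounded (g ` S)
        \<longrightarrow> (\<lambda>k. \<integral>x. g x \<partial>\<mu> k) \<longlonglongrightarrow> (\<integral>x. g x \<partial>\<nu>))"

definition weakly_continuous_kernel ::
  "'z::topological_space set \<Rightarrow> 'a::topological_space set \<Rightarrow> ('z \<times> 'a \<Rightarrow> 'z measure) \<Rightarrow> bool" where
  "weakly_continuous_kernel Z A \<eta> \<longleftrightarrow>
     (\<forall>x p. (\<forall>k. x k \<in> Z \<times> A) \<and> p \<in> Z \<times> A \<and> x \<longlonglongrightarrow> p
        \<longrightarrow> weakly_converges_on Z (\<lambda>k. \<eta> (x k)) (\<eta> p))"

end

theory Submission
  imports Defs
begin

text \<open>
  The minorization lets one subtract \<open>\<phi>(z,a) \<nu>\<close> from \<open>\<eta>(\<cdot>|z,a)\<close> and still have a (substochastic) kernel: the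
  process is killed with probability \<open>\<phi>(z,a)\<close>. The drift inequality says exactly that the killed kernel maps \<open>w\<close>
  below \<open>\<alpha> w\<close>. Hence, for every constant \<open>\<rho>\<close>, the dynamic programming operator of the killed process with
  one-stage cost \<open>c - \<rho>\<close> is a contraction with factor \<open>\<alpha>\<close> for the \<open>w\<close>-weighted supremum norm, and it
  has a fixed point \<open>h\<close>, the optimal killed cost. Weak continuity of \<open>\<eta>\<close>, continuity of \<open>\<integral>w d\<eta>\<close> and
  compactness of the action space make the operator preserve continuity, so \<open>h\<close> is continuous.

  The fixed point equation reads \<open>h(z) = inf\<^sub>a [c(z,a) - \<rho> + \<integral>h d\<eta>(z,a) - \<nu>(h) \<phi>(z,a)]\<close>. It becomes an
  average cost optimality inequality as soon as the sign of \<open>\<nu>(h)\<close> is known: if \<open>\<nu>(h) \<ge> 0\<close>, then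
  \<open>\<rho> + h \<le> c + \<integral>h d\<eta>\<close> for all actions and telescoping along any policy shows that no policy has average
  cost below \<open>\<rho>\<close>; if \<open>\<nu>(h) \<le> 0\<close>, then a measurable almost minimizing selector has average cost at most
  \<open>\<rho>\<close>, up to an arbitrarily small error. The boundary terms in the telescoping are harmless because the expectation of
  \<open>w(z\<^sub>t)\<close> stays bounded by the drift inequality (\<open>average_cost_ge\<close>, \<open>average_cost_le\<close>). So the value function is the constant
  \<open>sup {\<rho>. \<nu>(h\<^sub>\<rho>) \<ge> 0}\<close>, called \<open>gain\<close> below, for every
  nonempty action set \<open>B \<subseteq> A\<close> (lemma \<open>gain\<close>).

  For the limit, \<open>gain A \<le> gain (\<Lambda> n)\<close> because the lower bound for \<open>A\<close> holds for all actions in \<open>\<Lambda> n\<close>.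
  Conversely let \<open>\<rho> > gain A\<close>, so that \<open>\<nu>(h) < 0\<close> for the fixed point \<open>h\<close> of \<open>A\<close>. The operators of the
  individual action sets \<open>\<Lambda> n\<close> need not be monotone in \<open>n\<close>, and passing to the limit in their iterates would mean
  integrating varying functions against varying measures that converge only weakly. Monotonicity is restored by a game
  in which at each step an adversary first chooses some \<open>n > m\<close> and the controller then chooses an action in
  \<open>\<Lambda> n\<close>: its operator is still a contraction that preserves continuity, it dominates the operators of all \<open>\<Lambda> n\<close> with \<open>n > m\<close>, and it decreases in \<open>m\<close>. By
  monotonicity and dominated convergence its fixed points decrease pointwise to \<open>h\<close>, so their \<open>\<nu>\<close>-integrals
  are eventually negative (\<open>iterate_tail_limit\<close>, \<open>killed_value_tail_limit\<close>), and with them those of the fixed points for \<open>\<Lambda> n\<close>. Hence \<open>gain (\<Lambda> n) \<le> \<rho>\<close> for all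
  large \<open>n\<close>. For this reason all operators are defined for a family of action sets from the start.
\<close>

section \<open>Laws of the state-action pairs along a trajectory\<close>

text \<open>The law of one coordinate in terms of the finite-horizon measures. The first form keeps the prefix up to time \<open>t\<close>, so
that the next kernel can be applied to it; the second one exhibits the kernel that produces the coordinate itself.\<close>

lemma (in Ionescu_Tulcea) distr_lim_component:
  shows distr_lim_component_prefix:
      "distr PF.lim (M t) (\<lambda>\<omega>. \<omega> t) = distr (C 0 (Suc t) (\<lambda>_. undefined)) (M t) (\<lambda>x. x t)"
    and distr_lim_component_bind:
      "distr PF.lim (M t) (\<lambda>\<omega>. \<omega> t) = C 0 t (\<lambda>_. undefined) \<bind> P t"
proof -
  let ?u = "\<lambda>_::nat. undefined::'a"
  have u: "?u \<in> space (PiM {0..<0} M)" by (simp add: space_PiM)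
  have sC: "sets (C 0 n ?u) = sets (PiM {0..<n} M)" for n
    using sets_C[OF u, of n] by simp
  have spC: "space (C 0 n ?u) = space (PiM {0..<n} M)" for n
    using space_C[OF u, of n] by simp
  have [measurable]: "(\<lambda>x. x t) \<in> PiM {0..<Suc t} M \<rightarrow>\<^sub>M M t"
    by (rule measurable_component_singleton) simp
  have up: "up_to {0..<Suc t} = Suc t"
    by (intro antisym) (auto simp: up_to_iff Suc_le_eq up_to_less)
  have r: "(\<lambda>\<omega>. restrict \<omega> {0..<Suc t}) \<in> PF.lim \<rightarrow>\<^sub>M PiM {0..<Suc t} M"
    unfolding measurable_cong_sets[OF PF.sets_lim refl] by (rule measurable_restrict_subset) simp
  have r': "(\<lambda>\<omega>. restrict \<omega> {0..<Suc t}) \<in> C 0 (Suc t) ?u \<rightarrow>\<^sub>M PiM {0..<Suc t} M"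
    unfolding measurable_cong_sets[OF sC refl] by (rule measurable_restrict_subset) simp
  have *: "distr PF.lim (M t) (\<lambda>\<omega>. \<omega> t) = distr (C 0 (Suc t) ?u) (M t) (\<lambda>x. x t)"
  proof -
    have "distr PF.lim (M t) (\<lambda>\<omega>. \<omega> t) = distr (distr PF.lim (PiM {0..<Suc t} M) (\<lambda>\<omega>. restrict \<omega> {0..<Suc t})) (M t) (\<lambda>x. x t)"
      by (subst distr_distr[OF _ r]) (auto simp: comp_def)
    also have "\<dots> = distr (CI {0..<Suc t}) (M t) (\<lambda>x. x t)"
      by (simp add: distr_lim)
    also have "\<dots> = distr (C 0 (Suc t) ?u) (M t) (\<lambda>x. x t)"
      unfolding CI_def up by (subst distr_distr[OF _ r']) (auto simp: comp_def)
    finally show ?thesis .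
  qed
  also have "distr (C 0 (Suc t) ?u) (M t) (\<lambda>x. x t) = C 0 t ?u \<bind> (\<lambda>h. distr (eP t h) (M t) (\<lambda>x. x t))"
  proof -
    have "space (C 0 t ?u) \<noteq> {}"
      using prob_space.not_empty[OF prob_space_C[OF u]] by blast
    moreover have "eP t \<in> C 0 t ?u \<rightarrow>\<^sub>M subprob_algebra (PiM {0..<Suc t} M)"
      unfolding measurable_cong_sets[OF sC refl] by (rule measurable_eP)
    ultimately show ?thesis
      by (simp add: distr_bind)
  qed
  also have "\<dots> = C 0 t ?u \<bind> P t"
  proof (rule bind_cong[OF refl])
    fix h assume "h \<in> space (C 0 t ?u)"
    then have h: "h \<in> space (PiM {0..<t} M)" by (simp add: spC)
    have fu: "fun_upd h t \<in> P t h \<rightarrow>\<^sub>M PiM {0..<Suc t} M"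
      by (intro measurable_fun_upd[where J="{0..<t}"] measurable_const[OF h])
         (auto simp: measurable_cong_sets[OF sets_P[OF h] refl])
    show "distr (eP t h) (M t) (\<lambda>x. x t) = P t h"
      unfolding eP_def
      by (subst distr_distr[OF _ fu]) (auto simp: comp_def sets_P[OF h] intro: distr_id2)
  qed
  finally show "distr PF.lim (M t) (\<lambda>\<omega>. \<omega> t) = C 0 t ?u \<bind> P t" .
  show "distr PF.lim (M t) (\<lambda>\<omega>. \<omega> t) = distr (C 0 (Suc t) ?u) (M t) (\<lambda>x. x t)" by (rule *)
qed

definition state_action_law ::
  "'z::topological_space set \<Rightarrow> 'a::topological_space set \<Rightarrow> ('z \<times> 'a \<Rightarrow> 'z measure)
    \<Rightarrow> (nat \<Rightarrow> (nat \<Rightarrow> 'z \<times> 'a) \<times> 'z \<Rightarrow> 'a measure) \<Rightarrow> 'z \<Rightarrow> nat \<Rightarrow> ('z \<times> 'a) measure" where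
  "state_action_law Z B \<eta> \<pi> z t =
     distr (trajectory_measure Z B \<eta> \<pi> z) (borel_on Z \<Otimes>\<^sub>M borel_on B) (\<lambda>\<omega>. \<omega> t)"

locale controlled_process =
  fixes Z :: "'z::topological_space set" and B :: "'a::topological_space set"
    and \<eta> :: "'z \<times> 'a \<Rightarrow> 'z measure" and \<pi> :: "nat \<Rightarrow> (nat \<Rightarrow> 'z \<times> 'a) \<times> 'z \<Rightarrow> 'a measure" and z :: 'z
  assumes \<eta>_kernel [measurable]: "\<eta> \<in> borel_on Z \<Otimes>\<^sub>M borel_on B \<rightarrow>\<^sub>M prob_algebra (borel_on Z)"
    and policy: "\<pi> \<in> policies Z B" and start: "z \<in> Z"
begin

abbreviation "SA \<equiv> borel_on Z \<Otimes>\<^sub>M borel_on B"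
abbreviation "H t \<equiv> PiM {0..<t} (\<lambda>_::nat. SA)"
abbreviation "law \<equiv> state_action_law Z B \<eta> \<pi> z"

sublocale IT: Ionescu_Tulcea "step_kernel Z B \<eta> \<pi> z" "\<lambda>_. SA"
  by (rule Ionescu_Tulcea_step_kernel[OF \<eta>_kernel policy start])

text \<open>The conditional law of \<open>z\<^sub>t\<close>, before the action is drawn: \<open>step_kernel\<close> is this kernel followed by the policy.\<close>

definition state_kernel :: "nat \<Rightarrow> (nat \<Rightarrow> 'z \<times> 'a) \<Rightarrow> 'z measure" where
  "state_kernel t h = (if t = 0 then return (borel_on Z) z else \<eta> (h (t - 1)))"

lemma state_kernel_measurable [measurable]: "state_kernel t \<in> H t \<rightarrow>\<^sub>M prob_algebra (borel_on Z)"
proof (cases "t = 0")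
  case True
  have "return (borel_on Z) z \<in> space (prob_algebra (borel_on Z))"
    using start by (simp add: space_prob_algebra prob_space_return space_restrict_space)
  then show ?thesis
    using True by (simp add: state_kernel_def[abs_def])
next
  case False
  then have "t - 1 \<in> {0..<t}" by simp
  then have [measurable]: "(\<lambda>h. h (t - 1)) \<in> H t \<rightarrow>\<^sub>M SA"
    by (rule measurable_component_singleton)
  show ?thesis using False by (simp add: state_kernel_def[abs_def])
qed

lemma policy_measurable [measurable]: "\<pi> t \<in> H t \<Otimes>\<^sub>M borel_on Z \<rightarrow>\<^sub>M prob_algebra (borel_on B)"
  using policy by (auto simp: policies_def history_space_def)

lemma step_kernel_eq:
  "step_kernel Z B \<eta> \<pi> z t h = state_kernel t h \<bind> (\<lambda>y. \<pi> t (h, y) \<bind> (\<lambda>a. return SA (y, a)))"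
  by (simp add: step_kernel_def state_kernel_def)

lemma state_kernel_prob: 
  assumes "h \<in> space (H t)" 
  shows "prob_space (state_kernel t h)" "sets (state_kernel t h) = sets (borel_on Z)"
  using measurable_space[OF state_kernel_measurable assms] by (auto simp: space_prob_algebra)

lemma policy_prob: 
  assumes "h \<in> space (H t)" "y \<in> space (borel_on Z)"
  shows "prob_space (\<pi> t (h, y))" "sets (\<pi> t (h, y)) = sets (borel_on B)"
  using measurable_space[OF policy_measurable, of "(h, y)" t] assms by (auto simp: space_prob_algebra space_pair_measure)

lemma action_step_measurable [measurable]:
  assumes h: "h \<in> space (H t)"
  shows "(\<lambda>y. \<pi> t (h, y) \<bind> (\<lambda>a. return SA (y, a))) \<in> borel_on Z \<rightarrow>\<^sub>M prob_algebra SA"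
proof -
  have [measurable]: "(\<lambda>y. \<pi> t (h, y)) \<in> borel_on Z \<rightarrow>\<^sub>M prob_algebra (borel_on B)"
    using h by measurable
  show ?thesis by measurable
qed

lemma fst_step_kernel:
  assumes h: "h \<in> space (H t)"
  shows "distr (step_kernel Z B \<eta> \<pi> z t h) (borel_on Z) fst = state_kernel t h"
proof -
  interpret Q: prob_space "state_kernel t h" by (rule state_kernel_prob[OF h])
  note sQ = state_kernel_prob(2)[OF h]
  have sp: "space (state_kernel t h) = space (borel_on Z)" by (rule sets_eq_imp_space_eq[OF sQ])
  have "distr (step_kernel Z B \<eta> \<pi> z t h) (borel_on Z) fst
      = state_kernel t h \<bind> (\<lambda>y. distr (\<pi> t (h, y) \<bind> (\<lambda>a. return SA (y, a))) (borel_on Z) fst)"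
    unfolding step_kernel_eq
    by (rule distr_bind[where K=SA])
       (auto simp: measurable_cong_sets[OF sQ refl] Q.not_empty intro!: measurable_prob_algebraD action_step_measurable[OF h])
  also have "\<dots> = state_kernel t h \<bind> return (borel_on Z)"
  proof (rule bind_cong[OF refl])
    fix y assume "y \<in> space (state_kernel t h)"
    then have y: "y \<in> space (borel_on Z)" by (simp add: sp)
    interpret R: prob_space "\<pi> t (h, y)" by (rule policy_prob[OF h y])
    note sR = policy_prob(2)[OF h y]
    have spR: "space (\<pi> t (h, y)) = space (borel_on B)" by (rule sets_eq_imp_space_eq[OF sR])
    have pa: "(\<lambda>a. (y, a)) \<in> \<pi> t (h, y) \<rightarrow>\<^sub>M SA"
      using y by (simp add: measurable_cong_sets[OF sR refl])
    have "\<pi> t (h, y) \<bind> (\<lambda>a. return SA (y, a)) = distr (\<pi> t (h, y)) SA (\<lambda>a. (y, a))"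
      by (rule bind_return_distr'[OF R.not_empty pa])
    then show "distr (\<pi> t (h, y) \<bind> (\<lambda>a. return SA (y, a))) (borel_on Z) fst = return (borel_on Z) y"
      using y by (simp add: distr_distr[OF _ pa] comp_def)
  qed
  also have "\<dots> = state_kernel t h"
    by (rule bind_return''[OF sQ])
  finally show ?thesis .
qed

lemma law_eq: "law t = IT.C 0 t (\<lambda>_. undefined) \<bind> step_kernel Z B \<eta> \<pi> z t"
  unfolding state_action_law_def trajectory_measure_def by (rule IT.distr_lim_component_bind)

lemma sets_law [measurable_cong, simp]: "sets (law t) = sets SA"
  by (simp add: state_action_law_def)

lemma space_law [simp]: "space (law t) = space SA"
  by (simp add: state_action_law_def)

lemma sets_trajectory: "sets (trajectory_measure Z B \<eta> \<pi> z) = sets (PiM UNIV (\<lambda>_. SA))"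
  unfolding trajectory_measure_def by (rule IT.PF.sets_lim)

lemma component_measurable: "(\<lambda>\<omega>. \<omega> t) \<in> trajectory_measure Z B \<eta> \<pi> z \<rightarrow>\<^sub>M SA"
  unfolding measurable_cong_sets[OF sets_trajectory refl] by (rule measurable_component_singleton) simp

lemma prefix_measure:
  shows prefix_sets: "sets (IT.C 0 t (\<lambda>_. undefined)) = sets (H t)"
    and prefix_space: "space (IT.C 0 t (\<lambda>_. undefined)) = space (H t)"
    and prefix_prob: "prob_space (IT.C 0 t (\<lambda>_. undefined))"
proof -
  have u: "(\<lambda>_. undefined) \<in> space (H 0)" by (simp add: space_PiM)
  show "sets (IT.C 0 t (\<lambda>_. undefined)) = sets (H t)" using IT.sets_C[OF u, of t] by simp
  then show "space (IT.C 0 t (\<lambda>_. undefined)) = space (H t)" by (rule sets_eq_imp_space_eq)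
  show "prob_space (IT.C 0 t (\<lambda>_. undefined))" by (rule IT.prob_space_C[OF u])
qed

lemma step_kernel_measurable: 
  "step_kernel Z B \<eta> \<pi> z t \<in> IT.C 0 t (\<lambda>_. undefined) \<rightarrow>\<^sub>M subprob_algebra SA"
  unfolding measurable_cong_sets[OF prefix_sets refl] by (rule IT.P)

lemma prob_space_law: "prob_space (law t)"
proof -
  interpret prob_space "IT.C 0 t (\<lambda>_. undefined)" by (rule prefix_prob)
  show ?thesis
    unfolding law_eq
    by (rule prob_space_bind[OF _ step_kernel_measurable]) (auto simp: prefix_space IT.prob_space_P)
qed

lemma fst_law_eq: "distr (law t) (borel_on Z) fst = IT.C 0 t (\<lambda>_. undefined) \<bind> state_kernel t"
proof -
  interpret prob_space "IT.C 0 t (\<lambda>_. undefined)" by (rule prefix_prob)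
  show ?thesis
    unfolding law_eq
    by (subst distr_bind[OF step_kernel_measurable not_empty])
       (auto intro!: bind_cong simp: prefix_space fst_step_kernel)
qed

lemma fst_law_0: "distr (law 0) (borel_on Z) fst = return (borel_on Z) z"
proof -
  interpret prob_space "IT.C 0 0 (\<lambda>_. undefined)" by (rule prefix_prob)
  have "state_kernel 0 = (\<lambda>_. return (borel_on Z) z)" by (simp add: state_kernel_def fun_eq_iff)
  moreover have "subprob_space (return (borel_on Z) z)"
    using start by (intro prob_space_imp_subprob_space prob_space_return) (simp add: space_restrict_space)
  ultimately show ?thesis
    unfolding fst_law_eq using prob_space_axioms by (simp add: bind_const' del: IT.C.simps)
qed

text \<open>Averages of functions of the state are propagated by \<open>\<eta>\<close> alone: the policy matters only through the law of the current
state-action pair. Together with the initial law this is all that the verification argument uses about a general policy.\<close>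

lemma fst_law_Suc: "distr (law (Suc t)) (borel_on Z) fst = law t \<bind> \<eta>"
proof -
  interpret prob_space "IT.C 0 (Suc t) (\<lambda>_. undefined)" by (rule prefix_prob)
  have sk: "state_kernel (Suc t) = (\<lambda>h. \<eta> (h t))" by (simp add: state_kernel_def fun_eq_iff)
  have comp: "(\<lambda>h. h t) \<in> IT.C 0 (Suc t) (\<lambda>_. undefined) \<rightarrow>\<^sub>M SA"
    unfolding measurable_cong_sets[OF prefix_sets refl] by (rule measurable_component_singleton) simp
  have "law t = distr (IT.C 0 (Suc t) (\<lambda>_. undefined)) SA (\<lambda>h. h t)"
    unfolding state_action_law_def trajectory_measure_def by (rule IT.distr_lim_component_prefix)
  then have "law t \<bind> \<eta> = IT.C 0 (Suc t) (\<lambda>_. undefined) \<bind> (\<lambda>h. \<eta> (h t))"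
    by (simp only: bind_distr[OF comp measurable_prob_algebraD[OF \<eta>_kernel] not_empty])
  then show ?thesis unfolding fst_law_eq sk by simp
qed

text \<open>Under a deterministic stationary policy the state-action pair is concentrated on the graph of the selector. The statement
quantifies over predicates \<open>P\<close>, since then only \<open>P\<close> has to be measurable and not the graph.\<close>

lemma AE_law_stationary:
  assumes f [measurable]: "f \<in> borel_on Z \<rightarrow>\<^sub>M borel_on B"
    and \<pi>: "\<And>h y. \<pi> t (h, y) = return (borel_on B) (f y)"
    and P [measurable]: "Measurable.pred SA P" and Pf: "\<And>y. y \<in> Z \<Longrightarrow> P (y, f y)"
  shows "AE x in law t. P x"
proof -
  have "AE x in step_kernel Z B \<eta> \<pi> z t h. P x" if h: "h \<in> space (H t)" for h
  proof -
    note sQ = state_kernel_prob(2)[OF h]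
    have sp: "space (state_kernel t h) = space (borel_on Z)" by (rule sets_eq_imp_space_eq[OF sQ])
    have "AE x in \<pi> t (h, y) \<bind> (\<lambda>a. return SA (y, a)). P x" if y: "y \<in> space (borel_on Z)" for y
    proof -
      have fy: "f y \<in> space (borel_on B)" using measurable_space[OF f y] .
      have "(\<lambda>a. return SA (y, a)) \<in> borel_on B \<rightarrow>\<^sub>M subprob_algebra SA"
        using y by measurable
      then have "\<pi> t (h, y) \<bind> (\<lambda>a. return SA (y, a)) = return SA (y, f y)"
        unfolding \<pi> by (rule bind_return[OF _ fy])
      moreover have "AE x in return SA (y, f y). P x"
        using y fy Pf[of y] by (subst AE_return) (auto simp: space_pair_measure space_restrict_space)
      ultimately show ?thesis by (simp only:)
    qed
    moreover have "(\<lambda>y. \<pi> t (h, y) \<bind> (\<lambda>a. return SA (y, a))) \<in> state_kernel t h \<rightarrow>\<^sub>M subprob_algebra SA"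
      unfolding measurable_cong_sets[OF sQ refl] by (rule measurable_prob_algebraD[OF action_step_measurable[OF h]])
    ultimately show ?thesis
      unfolding step_kernel_eq by (subst AE_bind[where B=SA]) (auto simp: sp)
  qed
  then show ?thesis
    unfolding law_eq by (subst AE_bind[OF step_kernel_measurable P]) (auto simp: prefix_space)
qed

lemma average_cost_eq:
  assumes c: "c \<in> borel_measurable SA"
  shows "average_cost Z B \<eta> c \<pi> z = limsup (\<lambda>T. (\<Sum>t<T. \<integral>\<^sup>+x. c x \<partial>law t) / of_nat T)"
proof -
  have m: "(\<lambda>\<omega>. ennreal (c (\<omega> t))) \<in> borel_measurable (trajectory_measure Z B \<eta> \<pi> z)" for t
    using measurable_compose[OF component_measurable, of "\<lambda>x. ennreal (c x)" borel t] c by simp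
  have "(\<integral>\<^sup>+\<omega>. (\<Sum>t<T. ennreal (c (\<omega> t))) \<partial>trajectory_measure Z B \<eta> \<pi> z) = (\<Sum>t<T. \<integral>\<^sup>+x. c x \<partial>law t)" for T
    using c unfolding state_action_law_def
    by (subst nn_integral_sum[OF m], intro sum.cong refl)
       (rule nn_integral_distr[OF component_measurable, symmetric], simp)
  then show ?thesis by (simp add: average_cost_def)
qed

end

section \<open>Minimax values and measurable selection\<close>

text \<open>The value of a one-shot game: the adversary picks an action set from \<open>F\<close>, then the controller minimizes over it. A
singleton family gives an ordinary minimization problem.\<close>

definition minimax :: "'a set set \<Rightarrow> ('a \<Rightarrow> real) \<Rightarrow> real" where
  "minimax F q = (SUP B\<in>F. INF a\<in>B. q a)"

lemma abs_INF_le: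
  fixes q :: "'a \<Rightarrow> real"
  assumes "B \<noteq> {}" and q: "\<And>a. a \<in> B \<Longrightarrow> \<bar>q a\<bar> \<le> b"
  shows "bdd_below (q ` B)" "\<bar>INF a\<in>B. q a\<bar> \<le> b"
proof -
  show bdd: "bdd_below (q ` B)"
    using q by (intro bdd_belowI[of _ "- b"]) (auto simp: abs_le_iff minus_le_iff)
  obtain a where a: "a \<in> B" using \<open>B \<noteq> {}\<close> by auto
  have "(INF a\<in>B. q a) \<le> q a" by (rule cINF_lower[OF bdd a])
  moreover have "- b \<le> (INF a\<in>B. q a)"
    using q by (intro cINF_greatest[OF \<open>B \<noteq> {}\<close>]) (auto simp: abs_le_iff minus_le_iff)
  ultimately show "\<bar>INF a\<in>B. q a\<bar> \<le> b" using q[OF a] by linarith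
qed

lemma abs_minimax_le:
  assumes "F \<noteq> {}" "\<And>B. B \<in> F \<Longrightarrow> B \<noteq> {} \<and> B \<subseteq> A" and q: "\<And>a. a \<in> A \<Longrightarrow> \<bar>q a\<bar> \<le> b"
  shows "bdd_above ((\<lambda>B. INF a\<in>B. q a) ` F)" "\<bar>minimax F q\<bar> \<le> b"
proof -
  have I: "\<bar>INF a\<in>B. q a\<bar> \<le> b" if "B \<in> F" for B
    using assms(2)[OF that] q by (intro abs_INF_le(2)) auto
  show bdd: "bdd_above ((\<lambda>B. INF a\<in>B. q a) ` F)"
    using I by (intro bdd_aboveI[of _ b]) (auto simp: abs_le_iff)
  obtain B where B: "B \<in> F" using \<open>F \<noteq> {}\<close> by auto
  have "(INF a\<in>B. q a) \<le> minimax F q" unfolding minimax_def by (rule cSUP_upper[OF B bdd])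
  moreover have "minimax F q \<le> b"
    unfolding minimax_def using I by (intro cSUP_least[OF \<open>F \<noteq> {}\<close>]) (auto simp: abs_le_iff)
  ultimately show "\<bar>minimax F q\<bar> \<le> b" using I[OF B] by linarith
qed

text \<open>The adversary of the family \<open>G\<close> is at least as strong as that of \<open>F\<close> if every set in \<open>F\<close> contains a set in
\<open>G\<close>. This covers both a larger family and a family of smaller sets, and with equal families it gives the Lipschitz bound
on which contraction and continuity rest.\<close>

lemma minimax_mono:
  assumes "F \<noteq> {}" and G: "\<And>B. B \<in> G \<Longrightarrow> B \<noteq> {} \<and> B \<subseteq> A"
    and ref: "\<And>B. B \<in> F \<Longrightarrow> \<exists>B'\<in>G. B' \<subseteq> B" and F: "\<And>B. B \<in> F \<Longrightarrow> B \<subseteq> A"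
    and q: "\<And>a. a \<in> A \<Longrightarrow> \<bar>q a\<bar> \<le> b" and q': "\<And>a. a \<in> A \<Longrightarrow> \<bar>q' a\<bar> \<le> b'"
    and le: "\<And>a. a \<in> A \<Longrightarrow> q a \<le> q' a + e"
  shows "minimax F q \<le> minimax G q' + e"
  unfolding minimax_def
proof (rule cSUP_least[OF \<open>F \<noteq> {}\<close>])
  fix B assume B: "B \<in> F"
  then obtain B' where B': "B' \<in> G" "B' \<subseteq> B" using ref by blast
  have GF: "G \<noteq> {}" using B' by auto
  have "(INF a\<in>B. q a) - e \<le> (INF a\<in>B'. q' a)"
  proof (rule cINF_greatest)
    show "B' \<noteq> {}" using G B' by auto
    fix a assume a: "a \<in> B'"
    have aA: "a \<in> A" using a G B' by auto
    have "(INF a\<in>B. q a) \<le> q a"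
      using a B B' F q by (intro cINF_lower abs_INF_le(1)[where b=b]) auto
    then show "(INF a\<in>B. q a) - e \<le> q' a" using le[OF aA] by simp
  qed
  also have "\<dots> \<le> (SUP B\<in>G. INF a\<in>B. q' a)"
    by (rule cSUP_upper[OF B'(1) abs_minimax_le(1)[OF GF G q']])
  finally show "(INF a\<in>B. q a) \<le> (SUP B\<in>G. INF a\<in>B. q' a) + e" by simp
qed

lemma continuous_on_pair_measurable:
  fixes Z :: "'z::second_countable_topology set" and A :: "'a::second_countable_topology set"
    and g :: "'z \<times> 'a \<Rightarrow> 'b::topological_space"
  assumes "continuous_on (Z \<times> A) g"
  shows "g \<in> borel_measurable (borel_on Z \<Otimes>\<^sub>M borel_on A)"
proof -
  have [measurable]: "(\<lambda>x. x) \<in> borel_on Z \<rightarrow>\<^sub>M borel" "(\<lambda>x. x) \<in> borel_on A \<rightarrow>\<^sub>M borel"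
    by (auto intro: measurable_restrict_space1)
  have "(\<lambda>x::'z\<times>'a. x) \<in> borel_on Z \<Otimes>\<^sub>M borel_on A \<rightarrow>\<^sub>M restrict_space borel (Z \<times> A)"
  proof (rule measurable_restrict_space2)
    show "(\<lambda>x::'z\<times>'a. x) \<in> space (borel_on Z \<Otimes>\<^sub>M borel_on A) \<rightarrow> Z \<times> A"
      by (auto simp: space_pair_measure space_restrict_space)
    have "(\<lambda>x::'z\<times>'a. (fst x, snd x)) \<in> borel_on Z \<Otimes>\<^sub>M borel_on A \<rightarrow>\<^sub>M borel \<Otimes>\<^sub>M borel"
      by (intro measurable_Pair measurable_compose[OF measurable_fst] measurable_compose[OF measurable_snd]) measurable
    then show "(\<lambda>x::'z\<times>'a. x) \<in> borel_measurable (borel_on Z \<Otimes>\<^sub>M borel_on A)"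
      by (simp add: borel_prod)
  qed
  from measurable_compose[OF this borel_measurable_continuous_on_restrict[OF assms]] show ?thesis .
qed

text \<open>Since the inequality is strict and both sides are continuous, the good actions form a nonempty relatively open set, so the first good action in an enumeration of a countable dense subset of \<open>B\<close> is a measurable choice.\<close>

lemma measurable_selection_strict:
  fixes Z :: "'z::topological_space set" and B :: "'a::second_countable_topology set" and g :: "'z \<times> 'a \<Rightarrow> real"
  assumes "B \<noteq> {}" and g: "continuous_on (Z \<times> B) g" and b: "continuous_on Z b"
    and ex: "\<And>z. z \<in> Z \<Longrightarrow> \<exists>a\<in>B. g (z, a) < b z"
  obtains f where "f \<in> borel_on Z \<rightarrow>\<^sub>M borel_on B" "\<And>z. z \<in> Z \<Longrightarrow> g (z, f z) < b z"
proof -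
  obtain \<V> :: "'a set set" where \<V>: "countable \<V>" "topological_basis \<V>"
    using ex_countable_basis by blast
  define d where "d X = (SOME x. x \<in> X \<inter> B)" for X
  define D where "D = d ` {X \<in> \<V>. X \<inter> B \<noteq> {}}"
  have d: "d X \<in> X \<inter> B" if "X \<inter> B \<noteq> {}" for X
    unfolding d_def by (rule someI_ex) (use that in blast)
  have D: "countable D" "D \<subseteq> B"
    using \<V>(1) d by (auto simp: D_def)
  have dense: "\<exists>a\<in>D. a \<in> U" if "open U" "a0 \<in> U" "a0 \<in> B" for U a0
  proof -
    obtain X where X: "X \<in> \<V>" "a0 \<in> X" "X \<subseteq> U"
      using topological_basisE[OF \<V>(2) \<open>open U\<close> \<open>a0 \<in> U\<close>] by blast
    then have "X \<inter> B \<noteq> {}" using \<open>a0 \<in> B\<close> by auto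
    then show ?thesis using d[of X] X by (intro bexI[of _ "d X"]) (auto simp: D_def)
  qed
  have ne: "D \<noteq> {}" using dense[of UNIV] \<open>B \<noteq> {}\<close> by auto
  define e where "e = from_nat_into D"
  have e: "e i \<in> B" for i using from_nat_into[OF ne] D(2) by (auto simp: e_def)
  have ex': "\<exists>i. g (z, e i) < b z" if z: "z \<in> Z" for z
  proof -
    obtain a0 where a0: "a0 \<in> B" "g (z, a0) < b z" using ex[OF z] by blast
    have "continuous_on B (\<lambda>a. g (z, a))"
      using z by (intro continuous_on_compose2[OF g] continuous_intros) auto
    then obtain U where U: "open U" "U \<inter> B = (\<lambda>a. g (z, a)) -` {..<b z} \<inter> B"
      unfolding continuous_on_open_invariant using open_lessThan by blast
    have "a0 \<in> U" using U(2) a0 by blast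
    from dense[OF U(1) this a0(1)] obtain a where a: "a \<in> D" "a \<in> U" by blast
    then have "g (z, a) < b z" using U(2) D(2) by blast
    moreover obtain i where "a = e i"
      using a(1) D(1) unfolding e_def by (metis from_nat_into_surj)
    ultimately show ?thesis by blast
  qed
  define f where "f z = e (LEAST i. g (z, e i) < b z)" for z
  show thesis
  proof
    have pm: "Measurable.pred (borel_on Z) (\<lambda>z. g (z, e i) < b z)" for i
    proof -
      have "continuous_on Z (\<lambda>z. g (z, e i))"
        using e by (intro continuous_on_compose2[OF g] continuous_intros) auto
      from borel_measurable_continuous_on_restrict[OF this] borel_measurable_continuous_on_restrict[OF b]
      show ?thesis by measurable
    qed
    have "(\<lambda>z. LEAST i. g (z, e i) < b z) \<in> borel_on Z \<rightarrow>\<^sub>M count_space UNIV"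
      by (rule measurable_Least) (rule pm)
    moreover have "e \<in> count_space UNIV \<rightarrow>\<^sub>M borel_on B"
      using e by (simp add: space_restrict_space)
    ultimately show "f \<in> borel_on Z \<rightarrow>\<^sub>M borel_on B"
      unfolding f_def[abs_def] by (rule measurable_compose)
    fix z assume "z \<in> Z"
    from LeastI_ex[OF ex'[OF this]] show "g (z, f z) < b z" by (simp add: f_def)
  qed
qed

section \<open>The killed one-stage operator\<close>

locale weighted_mdp =
  fixes Z :: "'z::polish_space set" and A :: "'a::polish_space set"
    and \<eta> :: "'z \<times> 'a \<Rightarrow> 'z measure" and c :: "'z \<times> 'a \<Rightarrow> real" and M \<alpha> :: real
    and w :: "'z \<Rightarrow> real" and \<nu> :: "'z measure" and \<phi> :: "'z \<times> 'a \<Rightarrow> real"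
  assumes A_nonempty: "A \<noteq> {}"
    and kernel: "\<eta> \<in> borel_on Z \<Otimes>\<^sub>M borel_on A \<rightarrow>\<^sub>M prob_algebra (borel_on Z)"
    and c_nonneg: "\<And>z a. z \<in> Z \<Longrightarrow> a \<in> A \<Longrightarrow> 0 \<le> c (z, a)"
    and c_cont: "continuous_on (Z \<times> A) c"
    and weak_cont: "weakly_continuous_kernel Z A \<eta>"
    and A_compact: "compact A"
    and M_nonneg: "0 \<le> M"
    and w_ge_1: "\<And>z. z \<in> Z \<Longrightarrow> 1 \<le> w z"
    and w_cont: "continuous_on Z w"
    and c_le: "\<And>z a. z \<in> Z \<Longrightarrow> a \<in> A \<Longrightarrow> c (z, a) \<le> M * w z"
    and w_integrable: "\<And>z a. z \<in> Z \<Longrightarrow> a \<in> A \<Longrightarrow> integrable (\<eta> (z, a)) w"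
    and w_int_cont: "continuous_on (Z \<times> A) (\<lambda>x. \<integral>y. w y \<partial>\<eta> x)"
    and lambda_prob: "prob_space \<nu>" and lambda_sets: "sets \<nu> = sets (borel_on Z)"
    and phi_nonneg: "\<And>z a. z \<in> Z \<Longrightarrow> a \<in> A \<Longrightarrow> 0 \<le> \<phi> (z, a)"
    and phi_cont: "continuous_on (Z \<times> A) \<phi>"
    and alpha: "0 < \<alpha>" "\<alpha> < 1"
    and drift: "\<And>z a. z \<in> Z \<Longrightarrow> a \<in> A \<Longrightarrow>
        (\<integral>y. w y \<partial>\<eta> (z, a)) \<le> \<alpha> * w z + (\<integral>y. w y \<partial>\<nu>) * \<phi> (z, a)"
    and minorization: "\<And>z a D. z \<in> Z \<Longrightarrow> a \<in> A \<Longrightarrow> D \<in> sets (borel_on Z) \<Longrightarrow>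
        measure \<nu> D * \<phi> (z, a) \<le> measure (\<eta> (z, a)) D"
    and w_lambda_integrable: "integrable \<nu> w"
begin

sublocale \<nu>: prob_space \<nu> by (rule lambda_prob)

lemma eta_prob: "x \<in> Z \<times> A \<Longrightarrow> prob_space (\<eta> x)"
  and eta_sets: "x \<in> Z \<times> A \<Longrightarrow> sets (\<eta> x) = sets (borel_on Z)"
  using measurable_space[OF kernel, of x]
  by (auto simp: space_prob_algebra space_pair_measure space_restrict_space)

lemma eta_space: "x \<in> Z \<times> A \<Longrightarrow> space (\<eta> x) = Z"
  using sets_eq_imp_space_eq[OF eta_sets] by (simp add: space_restrict_space)

lemma lambda_space: "space \<nu> = Z"
  using sets_eq_imp_space_eq[OF lambda_sets] by (simp add: space_restrict_space)

lemma Z_nonempty: "Z \<noteq> {}"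
  using \<nu>.not_empty by (simp add: lambda_space)

text \<open>The ball of radius \<open>K\<close> in the weighted supremum norm. Continuity is part of the class because the kernel is only
weakly continuous and so controls limits of integrals of continuous functions only.\<close>

definition wfun :: "real \<Rightarrow> ('z \<Rightarrow> real) \<Rightarrow> bool" where
  "wfun K u \<longleftrightarrow> continuous_on Z u \<and> (\<forall>z\<in>Z. \<bar>u z\<bar> \<le> K * w z)"

lemma wfun_cont: "wfun K u \<Longrightarrow> continuous_on Z u"
  and wfun_le: "wfun K u \<Longrightarrow> z \<in> Z \<Longrightarrow> \<bar>u z\<bar> \<le> K * w z"
  by (auto simp: wfun_def)

lemma wfun_nonneg: "wfun K u \<Longrightarrow> 0 \<le> K"
proof -
  assume u: "wfun K u"
  obtain z where z: "z \<in> Z" using Z_nonempty by auto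
  have "0 \<le> K * w z" using wfun_le[OF u z] by linarith
  then show ?thesis using w_ge_1[OF z] by (simp add: zero_le_mult_iff)
qed

lemma wfun_w: "wfun 1 w"
  unfolding wfun_def
proof (intro conjI ballI w_cont)
  fix z assume "z \<in> Z"
  from w_ge_1[OF this] show "\<bar>w z\<bar> \<le> 1 * w z" by simp
qed

lemma wfun_measurable: "wfun K u \<Longrightarrow> u \<in> borel_measurable (borel_on Z)"
  by (intro borel_measurable_continuous_on_restrict wfun_cont)

lemma wfun_integrable:
  assumes u: "wfun K u"
  shows "x \<in> Z \<times> A \<Longrightarrow> integrable (\<eta> x) u" "integrable \<nu> u"
proof -
  have le: "norm (u z) \<le> norm (K * w z)" if "z \<in> Z" for z
    using wfun_le[OF u that] by simp
  show "integrable (\<eta> x) u" if x: "x \<in> Z \<times> A"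
  proof (rule Bochner_Integration.integrable_bound)
    show "integrable (\<eta> x) (\<lambda>y. K * w y)" using w_integrable x by auto
    show "u \<in> borel_measurable (\<eta> x)"
      using wfun_measurable[OF u] by (simp add: measurable_cong_sets[OF eta_sets[OF x] refl])
    show "AE y in \<eta> x. norm (u y) \<le> norm (K * w y)" by (intro AE_I2 le) (simp add: eta_space[OF x])
  qed
  show "integrable \<nu> u"
    using w_lambda_integrable le wfun_measurable[OF u]
    by (intro Bochner_Integration.integrable_bound[where f="\<lambda>y. K * w y" and g=u])
       (auto simp: lambda_space measurable_cong_sets[OF lambda_sets refl])
qed

text \<open>Weak convergence handles bounded functions only. Truncating a nonnegative \<open>g\<close> from above loses an arbitrarily small part of
the integral at the limit point and only decreases the integrals along the sequence; this gives one of the two inequalities.\<close>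

lemma eta_integral_lsc:
  assumes xs: "\<And>k. x k \<in> Z \<times> A" and p: "p \<in> Z \<times> A" and lim: "x \<longlonglongrightarrow> p"
    and g: "wfun K g" and g0: "\<And>z. z \<in> Z \<Longrightarrow> 0 \<le> g z" and "0 < e"
  shows "eventually (\<lambda>k. (\<integral>y. g y \<partial>\<eta> p) - e < (\<integral>y. g y \<partial>\<eta> (x k))) sequentially"
proof -
  define gN where "gN N y = min (g y) (real N)" for N :: nat and y
  have gN: "wfun K (gN N)" for N
    unfolding wfun_def
  proof (intro conjI ballI)
    show "continuous_on Z (gN N)"
      unfolding gN_def by (intro continuous_intros wfun_cont[OF g])
    fix z assume z: "z \<in> Z"
    show "\<bar>gN N z\<bar> \<le> K * w z"
      using wfun_le[OF g z] g0[OF z] by (simp add: gN_def min_def)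
  qed
  have "(\<lambda>N. \<integral>y. gN N y \<partial>\<eta> p) \<longlonglongrightarrow> (\<integral>y. g y \<partial>\<eta> p)"
  proof (rule integral_dominated_convergence[where w=g])
    show "g \<in> borel_measurable (\<eta> p)" "gN N \<in> borel_measurable (\<eta> p)" for N
      using wfun_measurable[OF g] wfun_measurable[OF gN] by (auto simp: measurable_cong_sets[OF eta_sets[OF p] refl])
    show "integrable (\<eta> p) g" by (rule wfun_integrable(1)[OF g p])
    show "AE y in \<eta> p. norm (gN N y) \<le> g y" for N
      using g0 by (intro AE_I2) (auto simp: eta_space[OF p] gN_def)
    show "AE y in \<eta> p. (\<lambda>N. gN N y) \<longlonglongrightarrow> g y"
    proof (rule AE_I2)
      fix y
      obtain N where N: "g y \<le> real N" using real_arch_simple by blast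
      have "eventually (\<lambda>n. gN n y = g y) sequentially"
        using eventually_ge_at_top[of N] by eventually_elim (use N in \<open>auto simp: gN_def\<close>)
      then show "(\<lambda>N. gN N y) \<longlonglongrightarrow> g y" by (rule tendsto_eventually)
    qed
  qed
  from order_tendstoD(1)[OF this, of "(\<integral>y. g y \<partial>\<eta> p) - e / 2"] \<open>0 < e\<close>
  obtain N where N: "(\<integral>y. g y \<partial>\<eta> p) - e / 2 < (\<integral>y. gN N y \<partial>\<eta> p)"
    by (auto simp: eventually_sequentially)
  have "bounded (gN N ` Z)"
    using g0 by (intro boundedI[of _ "real N"]) (auto simp: gN_def)
  then have "(\<lambda>k. \<integral>y. gN N y \<partial>\<eta> (x k)) \<longlonglongrightarrow> (\<integral>y. gN N y \<partial>\<eta> p)"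
    using weak_cont xs p lim wfun_cont[OF gN]
    by (auto simp: weakly_continuous_kernel_def weakly_converges_on_def)
  from order_tendstoD(1)[OF this, of "(\<integral>y. gN N y \<partial>\<eta> p) - e / 2"] \<open>0 < e\<close>
  have "eventually (\<lambda>k. (\<integral>y. gN N y \<partial>\<eta> p) - e / 2 < (\<integral>y. gN N y \<partial>\<eta> (x k))) sequentially" by simp
  then show ?thesis
  proof eventually_elim
    case (elim k)
    have "(\<integral>y. gN N y \<partial>\<eta> (x k)) \<le> (\<integral>y. g y \<partial>\<eta> (x k))"
      by (intro integral_mono wfun_integrable(1)[OF gN xs] wfun_integrable(1)[OF g xs]) (simp add: gN_def)
    then show ?case using elim N by linarith
  qed
qed

text \<open>Lower semicontinuity is applied to the two nonnegative functions \<open>K w + u\<close> and \<open>K w - u\<close>. Since \<open>\<integral>w d\<eta>\<close> is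
continuous, the second one yields upper semicontinuity of \<open>\<integral>u d\<eta>\<close>.\<close>

lemma eta_integral_continuous:
  assumes u: "wfun K u"
  shows "continuous_on (Z \<times> A) (\<lambda>x. \<integral>y. u y \<partial>\<eta> x)"
  unfolding continuous_on_sequentially comp_def
proof (intro allI ballI impI, elim conjE)
  fix x p assume p: "p \<in> Z \<times> A" and "\<forall>n. x n \<in> Z \<times> A" and lim: "x \<longlonglongrightarrow> p"
  then have xs: "\<And>k. x k \<in> Z \<times> A" by blast
  have wl: "(\<lambda>k. \<integral>y. w y \<partial>\<eta> (x k)) \<longlonglongrightarrow> (\<integral>y. w y \<partial>\<eta> p)"
    using w_int_cont p xs lim unfolding continuous_on_sequentially comp_def by blast
  have Kw: "wfun (2 * K) (\<lambda>y. K * w y + s * u y)" if "\<bar>s\<bar> = 1" for s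
    unfolding wfun_def
  proof (intro conjI ballI)
    show "continuous_on Z (\<lambda>y. K * w y + s * u y)"
      by (intro continuous_intros wfun_cont[OF u] w_cont)
    fix z assume z: "z \<in> Z"
    have "\<bar>s * u z\<bar> = \<bar>u z\<bar>" using that by (simp add: abs_mult)
    then show "\<bar>K * w z + s * u z\<bar> \<le> 2 * K * w z"
      using wfun_le[OF u z] by linarith
  qed
  have Kw0: "0 \<le> K * w z + s * u z" if "\<bar>s\<bar> = 1" "z \<in> Z" for s z
  proof -
    have "\<bar>s * u z\<bar> = \<bar>u z\<bar>" using that by (simp add: abs_mult)
    then show ?thesis using wfun_le[OF u that(2)] by linarith
  qed
  have int: "(\<integral>y. K * w y + s * u y \<partial>\<eta> q) = K * (\<integral>y. w y \<partial>\<eta> q) + s * (\<integral>y. u y \<partial>\<eta> q)"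
    if "q \<in> Z \<times> A" for s q
    using wfun_integrable(1)[OF u that] wfun_integrable(1)[OF wfun_w that] by simp
  show "(\<lambda>k. \<integral>y. u y \<partial>\<eta> (x k)) \<longlonglongrightarrow> (\<integral>y. u y \<partial>\<eta> p)"
  proof (rule tendstoI)
    fix e :: real assume "0 < e"
    have ev: "eventually (\<lambda>k. K * (\<integral>y. w y \<partial>\<eta> p) + s * (\<integral>y. u y \<partial>\<eta> p) - e / 2
        < K * (\<integral>y. w y \<partial>\<eta> (x k)) + s * (\<integral>y. u y \<partial>\<eta> (x k))) sequentially" if "\<bar>s\<bar> = 1" for s
      using eta_integral_lsc[OF xs p lim Kw[OF that] Kw0[OF that], of "e / 2"] \<open>0 < e\<close>
      by (simp add: int[OF p] int[OF xs])
    have "(\<lambda>k. K * (\<integral>y. w y \<partial>\<eta> (x k))) \<longlonglongrightarrow> K * (\<integral>y. w y \<partial>\<eta> p)"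
      by (intro tendsto_intros wl)
    from order_tendstoD(2)[OF this, of "K * (\<integral>y. w y \<partial>\<eta> p) + e / 2"] \<open>0 < e\<close>
    have "eventually (\<lambda>k. K * (\<integral>y. w y \<partial>\<eta> (x k)) < K * (\<integral>y. w y \<partial>\<eta> p) + e / 2) sequentially" by simp
    with ev[of 1, simplified] ev[of "-1", simplified]
    show "eventually (\<lambda>k. dist (\<integral>y. u y \<partial>\<eta> (x k)) (\<integral>y. u y \<partial>\<eta> p) < e) sequentially"
      by eventually_elim (auto simp: dist_real_def abs_less_iff)
  qed
qed

lemma minorization_integral:
  assumes x: "x \<in> Z \<times> A" and g: "wfun K g" and g0: "\<And>z. z \<in> Z \<Longrightarrow> 0 \<le> g z"
  shows "(\<integral>y. g y \<partial>\<nu>) * \<phi> x \<le> (\<integral>y. g y \<partial>\<eta> x)"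
proof -
  interpret E: prob_space "\<eta> x" by (rule eta_prob[OF x])
  have \<phi>0: "0 \<le> \<phi> x" using x phi_nonneg by auto
  have same_sets: "sets (scale_measure (ennreal (\<phi> x)) \<nu>) = sets (\<eta> x)"
    using lambda_sets eta_sets[OF x] by simp
  have "emeasure (scale_measure (ennreal (\<phi> x)) \<nu>) \<le> emeasure (\<eta> x)"
  proof (rule le_funI)
    fix D show "emeasure (scale_measure (ennreal (\<phi> x)) \<nu>) D \<le> emeasure (\<eta> x) D"
    proof (cases "D \<in> sets (borel_on Z)")
      case True
      obtain z a where za: "x = (z, a)" "z \<in> Z" "a \<in> A" using x by auto
      have "measure \<nu> D * \<phi> x \<le> measure (\<eta> x) D" using minorization[OF za(2,3) True] za(1) by simp
      then show ?thesis
        using \<phi>0 by (simp add: E.emeasure_eq_measure \<nu>.emeasure_eq_measure ennreal_mult[symmetric] mult.commute ennreal_leI)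
    next
      case False
      then show ?thesis using lambda_sets by (simp add: emeasure_notin_sets)
    qed
  qed
  then have "scale_measure (ennreal (\<phi> x)) \<nu> \<le> \<eta> x"
    by (simp add: le_measure[OF same_sets] le_fun_def)
  then have "(\<integral>\<^sup>+y. g y \<partial>scale_measure (ennreal (\<phi> x)) \<nu>) \<le> (\<integral>\<^sup>+y. g y \<partial>\<eta> x)"
    by (intro nn_integral_mono_measure) (simp_all add: lambda_sets eta_sets[OF x])
  moreover have "(\<integral>\<^sup>+y. g y \<partial>scale_measure (ennreal (\<phi> x)) \<nu>) = ennreal (\<phi> x) * (\<integral>\<^sup>+y. g y \<partial>\<nu>)"
    using wfun_measurable[OF g] by (intro nn_integral_scale_measure) (simp add: measurable_cong_sets[OF lambda_sets refl])
  moreover have "(\<integral>\<^sup>+y. g y \<partial>\<nu>) = ennreal (\<integral>y. g y \<partial>\<nu>)"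
    using g0 by (intro nn_integral_eq_integral wfun_integrable(2)[OF g] AE_I2) (simp add: lambda_space)
  moreover have "(\<integral>\<^sup>+y. g y \<partial>\<eta> x) = ennreal (\<integral>y. g y \<partial>\<eta> x)"
    using g0 by (intro nn_integral_eq_integral wfun_integrable(1)[OF g x] AE_I2) (simp add: eta_space[OF x])
  moreover have "0 \<le> (\<integral>y. g y \<partial>\<nu>)" "0 \<le> (\<integral>y. g y \<partial>\<eta> x)"
    using g0 by (auto intro!: integral_nonneg_AE simp: lambda_space eta_space[OF x])
  ultimately show ?thesis
    using \<phi>0 by (simp add: ennreal_mult[symmetric] mult.commute)
qed

lemma phi_le_1: "x \<in> Z \<times> A \<Longrightarrow> \<phi> x \<le> 1"
proof -
  assume x: "x \<in> Z \<times> A"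
  obtain z a where za: "x = (z, a)" "z \<in> Z" "a \<in> A" using x by auto
  interpret E: prob_space "\<eta> x" by (rule eta_prob[OF x])
  have "Z \<in> sets (borel_on Z)" using sets.top[of "borel_on Z"] by (simp add: space_restrict_space)
  from minorization[OF za(2,3) this] show ?thesis
    using E.prob_space[unfolded eta_space[OF x]] \<nu>.prob_space[unfolded lambda_space] by (simp add: za(1))
qed

text \<open>The cost of one step with charge \<open>\<rho>\<close> and continuation cost \<open>u\<close>, where the expectation of \<open>u\<close> is taken under the
killed kernel \<open>\<eta>(\<cdot>|x) - \<phi>(x) \<nu>\<close>.\<close>

definition Q :: "real \<Rightarrow> ('z \<Rightarrow> real) \<Rightarrow> 'z \<times> 'a \<Rightarrow> real" where
  "Q \<rho> u x = c x - \<rho> + ((\<integral>y. u y \<partial>\<eta> x) - (\<integral>y. u y \<partial>\<nu>) * \<phi> x)"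

text \<open>The killed kernel is monotone by the minorization and shrinks \<open>w\<close> by the factor \<open>\<alpha>\<close> by the drift inequality; both
are used here, and the contraction property is the consequence.\<close>

lemma Q_mono:
  assumes u: "wfun K u" and v: "wfun K' v" and x: "z \<in> Z" "a \<in> A"
    and "0 \<le> k" and le: "\<And>y. y \<in> Z \<Longrightarrow> u y \<le> v y + k * w y"
  shows "Q \<rho> u (z, a) \<le> Q \<rho> v (z, a) + \<alpha> * k * w z"
proof -
  have x': "(z, a) \<in> Z \<times> A" using x by simp
  let ?g = "\<lambda>y. v y + k * w y - u y"
  have "wfun (K' + k + K) ?g"
    unfolding wfun_def
  proof (intro conjI ballI)
    show "continuous_on Z ?g" by (intro continuous_intros wfun_cont[OF u] wfun_cont[OF v] w_cont)
    fix y assume y: "y \<in> Z"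
    have "\<bar>?g y\<bar> \<le> \<bar>v y\<bar> + \<bar>k * w y\<bar> + \<bar>u y\<bar>" by linarith
    also have "\<bar>k * w y\<bar> = k * w y" using \<open>0 \<le> k\<close> w_ge_1[OF y] by simp
    finally show "\<bar>?g y\<bar> \<le> (K' + k + K) * w y"
      using wfun_le[OF u y] wfun_le[OF v y] by (simp add: algebra_simps)
  qed
  from minorization_integral[OF x' this] le
  have "((\<integral>y. v y \<partial>\<nu>) + k * (\<integral>y. w y \<partial>\<nu>) - (\<integral>y. u y \<partial>\<nu>)) * \<phi> (z, a)
      \<le> (\<integral>y. v y \<partial>\<eta> (z, a)) + k * (\<integral>y. w y \<partial>\<eta> (z, a)) - (\<integral>y. u y \<partial>\<eta> (z, a))"
    using wfun_integrable(1)[OF u x'] wfun_integrable(1)[OF v x'] w_integrable[OF x]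
      wfun_integrable(2)[OF u] wfun_integrable(2)[OF v] w_lambda_integrable by simp
  moreover have "k * (\<integral>y. w y \<partial>\<eta> (z, a)) \<le> k * (\<alpha> * w z + (\<integral>y. w y \<partial>\<nu>) * \<phi> (z, a))"
    using drift[OF x] \<open>0 \<le> k\<close> by (rule mult_left_mono)
  ultimately show ?thesis
    unfolding Q_def by (simp add: algebra_simps)
qed

lemma Q_bound:
  assumes u: "wfun K u" and x: "z \<in> Z" "a \<in> A"
  shows "\<bar>Q \<rho> u (z, a)\<bar> \<le> (M + \<bar>\<rho>\<bar> + \<alpha> * K) * w z"
proof -
  have K: "0 \<le> K" by (rule wfun_nonneg[OF u])
  have z0: "wfun 0 (\<lambda>_. 0)" by (simp add: wfun_def)
  have Q0: "Q \<rho> (\<lambda>_. 0) (z, a) = c (z, a) - \<rho>" by (simp add: Q_def)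
  have "Q \<rho> u (z, a) \<le> Q \<rho> (\<lambda>_. 0) (z, a) + \<alpha> * K * w z"
    by (intro Q_mono[OF u z0 x K]) (use wfun_le[OF u] in \<open>auto simp: abs_le_iff\<close>)
  moreover have "Q \<rho> (\<lambda>_. 0) (z, a) \<le> Q \<rho> u (z, a) + \<alpha> * K * w z"
  proof (rule Q_mono[OF z0 u x K])
    fix y assume "y \<in> Z"
    from wfun_le[OF u this] show "0 \<le> u y + K * w y" by linarith
  qed
  moreover have "\<bar>\<rho>\<bar> \<le> \<bar>\<rho>\<bar> * w z" using w_ge_1[OF x(1)] by (simp add: mult_le_cancel_left1)
  moreover have "0 \<le> c (z, a)" "c (z, a) \<le> M * w z" using c_nonneg[OF x] c_le[OF x] .
  ultimately show ?thesis unfolding Q0 by (simp add: algebra_simps)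
qed

lemma Q_continuous: "wfun K u \<Longrightarrow> continuous_on (Z \<times> A) (Q \<rho> u)"
  unfolding Q_def[abs_def] by (intro continuous_intros c_cont eta_integral_continuous phi_cont)

end

section \<open>Verification inequalities for the average cost\<close>

context weighted_mdp begin

abbreviation "w_mean \<equiv> (\<integral>y. w y \<partial>\<nu>)"

lemma w_mean_nonneg: "0 \<le> w_mean"
  using w_ge_1 by (intro integral_nonneg_AE AE_I2) (force simp: lambda_space)

lemma restricted_kernel:
  assumes "B \<subseteq> A" shows "\<eta> \<in> borel_on Z \<Otimes>\<^sub>M borel_on B \<rightarrow>\<^sub>M prob_algebra (borel_on Z)"
proof -
  have incl: "(\<lambda>x. x) \<in> borel_on B \<rightarrow>\<^sub>M borel_on A"
    using assms by (intro measurable_restrict_space2 measurable_restrict_space1) (auto simp: space_restrict_space)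
  have "(\<lambda>x. (fst x, snd x)) \<in> borel_on Z \<Otimes>\<^sub>M borel_on B \<rightarrow>\<^sub>M borel_on Z \<Otimes>\<^sub>M borel_on A"
    by (intro measurable_Pair measurable_fst measurable_compose[OF measurable_snd incl])
  from measurable_compose[OF this kernel] show ?thesis by simp
qed

end

text \<open>A policy that uses actions in \<open>B\<close> only. Keeping \<open>B\<close> apart from \<open>A\<close> treats the original model and all quantized
models at once.\<close>

locale weighted_mdp_policy = weighted_mdp Z A \<eta> c M \<alpha> w \<nu> \<phi> + controlled_process Z B \<eta> \<pi> z
  for Z :: "'z::polish_space set" and A :: "'a::polish_space set" and \<eta> c M \<alpha> w \<nu> \<phi> B \<pi> z +
  assumes B_subset: "B \<subseteq> A"
begin

lemma space_law_subset: "x \<in> space (law t) \<Longrightarrow> x \<in> Z \<times> B" "x \<in> space (law t) \<Longrightarrow> x \<in> Z \<times> A"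
  using B_subset by (auto simp: space_pair_measure space_restrict_space)

lemma cont_law_measurable:
  fixes g :: "'z \<times> 'a \<Rightarrow> real"
  assumes "continuous_on (Z \<times> A) g" shows "g \<in> borel_measurable (law t)"
proof -
  have "continuous_on (Z \<times> B) g" using assms B_subset by (rule_tac continuous_on_subset) auto
  from continuous_on_pair_measurable[OF this] show ?thesis
    by (simp add: measurable_cong_sets[OF sets_law refl])
qed

lemma wfun_fst_measurable: "wfun K u \<Longrightarrow> (\<lambda>x. u (fst x)) \<in> borel_measurable (law t)"
  using measurable_compose[OF measurable_fst wfun_measurable, of K u "borel_on B"]
  by (simp add: measurable_cong_sets[OF sets_law refl])

lemma nn_integral_law_0:
  assumes [measurable]: "g \<in> borel_measurable (borel_on Z)"
  shows "(\<integral>\<^sup>+x. g (fst x) \<partial>law 0) = g z"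
proof -
  have "(\<integral>\<^sup>+x. g (fst x) \<partial>law 0) = (\<integral>\<^sup>+y. g y \<partial>distr (law 0) (borel_on Z) fst)"
    by (subst nn_integral_distr) auto
  also have "\<dots> = g z"
    unfolding fst_law_0 using start by (subst nn_integral_return) (auto simp: space_restrict_space)
  finally show ?thesis .
qed

lemma nn_integral_law_Suc:
  assumes [measurable]: "g \<in> borel_measurable (borel_on Z)"
  shows "(\<integral>\<^sup>+x. g (fst x) \<partial>law (Suc t)) = (\<integral>\<^sup>+x. \<integral>\<^sup>+y. g y \<partial>\<eta> x \<partial>law t)"
proof -
  have "(\<integral>\<^sup>+x. g (fst x) \<partial>law (Suc t)) = (\<integral>\<^sup>+y. g y \<partial>distr (law (Suc t)) (borel_on Z) fst)"
    by (subst nn_integral_distr) auto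
  also have "\<dots> = (\<integral>\<^sup>+x. \<integral>\<^sup>+y. g y \<partial>\<eta> x \<partial>law t)"
    unfolding fst_law_Suc
    by (rule nn_integral_bind[OF assms]) (simp add: measurable_cong_sets[OF sets_law refl] measurable_prob_algebraD)
  finally show ?thesis .
qed

text \<open>A number above the initial value \<open>w z\<close> that the drift map \<open>x \<mapsto> \<alpha> x + \<nu>(w)\<close> does not increase, hence a
bound for the expectation of \<open>w\<close> at all times.\<close>

definition moment_bound :: real where "moment_bound = w z + w_mean / (1 - \<alpha>)"

lemma moment_bound_nonneg: "0 \<le> moment_bound"
  using w_ge_1[OF start] w_mean_nonneg alpha by (auto simp: moment_bound_def intro!: add_nonneg_nonneg divide_nonneg_nonneg)

lemma weight_moment: "(\<integral>\<^sup>+x. w (fst x) \<partial>law t) \<le> ennreal moment_bound"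
proof (induction t)
  case 0
  have "(\<integral>\<^sup>+x. w (fst x) \<partial>law 0) = ennreal (w z)"
    using wfun_measurable[OF wfun_w] by (subst nn_integral_law_0) auto
  also have "\<dots> \<le> ennreal moment_bound"
    using w_mean_nonneg alpha by (intro ennreal_leI) (simp add: moment_bound_def)
  finally show ?case .
next
  case (Suc t)
  interpret P: prob_space "law t" by (rule prob_space_law)
  have "(\<integral>\<^sup>+x. w (fst x) \<partial>law (Suc t)) = (\<integral>\<^sup>+x. \<integral>\<^sup>+y. w y \<partial>\<eta> x \<partial>law t)"
    using wfun_measurable[OF wfun_w] by (subst nn_integral_law_Suc) auto
  also have "\<dots> \<le> (\<integral>\<^sup>+x. ennreal \<alpha> * ennreal (w (fst x)) + ennreal w_mean \<partial>law t)"
  proof (rule nn_integral_mono)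
    fix x assume "x \<in> space (law t)"
    then have x: "x \<in> Z \<times> A" by (rule space_law_subset)
    then obtain y a where ya: "x = (y, a)" "y \<in> Z" "a \<in> A" by auto
    have "(\<integral>\<^sup>+y. w y \<partial>\<eta> x) = ennreal (\<integral>y. w y \<partial>\<eta> x)"
      using w_ge_1 by (intro nn_integral_eq_integral wfun_integrable(1)[OF wfun_w x] AE_I2) (force simp: eta_space[OF x])
    also have "\<dots> \<le> ennreal (\<alpha> * w (fst x) + w_mean)"
    proof (rule ennreal_leI)
      have "w_mean * \<phi> x \<le> w_mean" using mult_left_mono[OF phi_le_1[OF x] w_mean_nonneg] by simp
      then show "(\<integral>y. w y \<partial>\<eta> x) \<le> \<alpha> * w (fst x) + w_mean" using drift[OF ya(2,3)] ya(1) by simp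
    qed
    also have "\<dots> = ennreal \<alpha> * ennreal (w (fst x)) + ennreal w_mean"
      using w_ge_1[OF ya(2)] alpha w_mean_nonneg ya(1) by (simp add: ennreal_plus ennreal_mult)
    finally show "(\<integral>\<^sup>+y. w y \<partial>\<eta> x) \<le> \<dots>" .
  qed
  also have "\<dots> = ennreal \<alpha> * (\<integral>\<^sup>+x. w (fst x) \<partial>law t) + ennreal w_mean"
    using wfun_fst_measurable[OF wfun_w]
    by (subst nn_integral_add) (auto simp: nn_integral_cmult P.emeasure_space_1 simp del: space_law)
  also have "\<dots> \<le> ennreal \<alpha> * ennreal moment_bound + ennreal w_mean"
    by (intro add_right_mono mult_left_mono Suc.IH) simp
  also have "\<dots> = ennreal (\<alpha> * moment_bound + w_mean)"
    using alpha moment_bound_nonneg w_mean_nonneg by (simp add: ennreal_plus ennreal_mult)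
  also have "\<dots> \<le> ennreal moment_bound"
  proof (rule ennreal_leI)
    have "\<alpha> * moment_bound + w_mean = \<alpha> * w z + w_mean / (1 - \<alpha>)" using alpha by (simp add: moment_bound_def field_simps)
    moreover have "\<alpha> * w z \<le> w z" using alpha w_ge_1[OF start] by (simp add: mult_le_cancel_right1)
    ultimately show "\<alpha> * moment_bound + w_mean \<le> moment_bound" by (simp add: moment_bound_def)
  qed
  finally show ?case .
qed

lemma weight_integrable: "integrable (law t) (\<lambda>x. w (fst x))"
  and weight_integral: "(\<integral>x. w (fst x) \<partial>law t) \<le> moment_bound"
proof -
  have w0: "AE x in law t. 0 \<le> w (fst x)"
    using w_ge_1 space_law_subset(1) by (intro AE_I2) (force simp del: space_law)
  show i: "integrable (law t) (\<lambda>x. w (fst x))"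
    using le_less_trans[OF weight_moment ennreal_less_top] w0
    by (intro integrableI_nonneg wfun_fst_measurable[OF wfun_w]) auto
  show "(\<integral>x. w (fst x) \<partial>law t) \<le> moment_bound"
    using weight_moment[of t] moment_bound_nonneg by (simp add: nn_integral_eq_integral[OF i w0])
qed

lemma wfun_law_integrable:
  assumes u: "wfun K u"
  shows "integrable (law t) (\<lambda>x. u (fst x))" "\<bar>\<integral>x. u (fst x) \<partial>law t\<bar> \<le> K * moment_bound"
proof -
  have le: "\<bar>u (fst x)\<bar> \<le> K * w (fst x)" if "x \<in> space (law t)" for x
    using wfun_le[OF u, of "fst x"] space_law_subset(1)[OF that] by auto
  have iw: "integrable (law t) (\<lambda>x. K * w (fst x))" using weight_integrable by simp
  show i: "integrable (law t) (\<lambda>x. u (fst x))"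
  proof (rule Bochner_Integration.integrable_bound[OF iw wfun_fst_measurable[OF u]])
    show "AE x in law t. norm (u (fst x)) \<le> norm (K * w (fst x))"
      by (intro AE_I2) (use le in force)
  qed
  have "\<bar>\<integral>x. u (fst x) \<partial>law t\<bar> \<le> (\<integral>x. K * w (fst x) \<partial>law t)"
    by (rule order_trans[OF integral_abs_bound integral_mono[OF integrable_abs[OF i] iw le]])
  also have "\<dots> \<le> K * moment_bound"
    using mult_left_mono[OF weight_integral wfun_nonneg[OF u]] by simp
  finally show "\<bar>\<integral>x. u (fst x) \<partial>law t\<bar> \<le> K * moment_bound" .
qed

lemma eta_integral_law_integrable:
  assumes u: "wfun K u" shows "integrable (law t) (\<lambda>x. \<integral>y. u y \<partial>\<eta> x)"
proof -
  interpret P: prob_space "law t" by (rule prob_space_law)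
  have i: "integrable (law t) (\<lambda>x. K * (\<alpha> * w (fst x) + w_mean))"
    using weight_integrable by simp
  show ?thesis
  proof (rule Bochner_Integration.integrable_bound[OF i cont_law_measurable[OF eta_integral_continuous[OF u]]])
    have "norm (\<integral>y. u y \<partial>\<eta> x) \<le> norm (K * (\<alpha> * w (fst x) + w_mean))" if "x \<in> space (law t)" for x
    proof -
      have x: "x \<in> Z \<times> A" by (rule space_law_subset(2)[OF that])
      then obtain y a where ya: "x = (y, a)" "y \<in> Z" "a \<in> A" by auto
      have "\<bar>\<integral>y. u y \<partial>\<eta> x\<bar> \<le> (\<integral>y. \<bar>u y\<bar> \<partial>\<eta> x)" by (rule integral_abs_bound)
      also have "\<dots> \<le> (\<integral>y. K * w y \<partial>\<eta> x)"
        using wfun_integrable(1)[OF wfun_w x] wfun_integrable(1)[OF u x] wfun_le[OF u]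
        by (intro integral_mono) (auto simp: eta_space[OF x])
      also have "\<dots> = K * (\<integral>y. w y \<partial>\<eta> x)" by simp
      also have "\<dots> \<le> K * (\<alpha> * w (fst x) + w_mean)"
      proof (rule mult_left_mono[OF _ wfun_nonneg[OF u]])
        have "w_mean * \<phi> x \<le> w_mean" using mult_left_mono[OF phi_le_1[OF x] w_mean_nonneg] by simp
        then show "(\<integral>y. w y \<partial>\<eta> x) \<le> \<alpha> * w (fst x) + w_mean" using drift[OF ya(2,3)] ya(1) by simp
      qed
      finally show ?thesis by simp
    qed
    then show "AE x in law t. norm (\<integral>y. u y \<partial>\<eta> x) \<le> norm (K * (\<alpha> * w (fst x) + w_mean))" by (rule AE_I2)
  qed
qed

lemma integral_law_Suc_nonneg:
  assumes g: "wfun K g" and g0: "\<And>y. y \<in> Z \<Longrightarrow> 0 \<le> g y"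
  shows "(\<integral>x. g (fst x) \<partial>law (Suc t)) = (\<integral>x. (\<integral>y. g y \<partial>\<eta> x) \<partial>law t)"
proof -
  have "(\<integral>x. g (fst x) \<partial>law (Suc t)) = enn2real (\<integral>\<^sup>+x. g (fst x) \<partial>law (Suc t))"
    using g0 space_law_subset(1)
    by (intro integral_eq_nn_integral wfun_fst_measurable[OF g] AE_I2) (force simp del: space_law)
  also have "(\<integral>\<^sup>+x. g (fst x) \<partial>law (Suc t)) = (\<integral>\<^sup>+x. \<integral>\<^sup>+y. g y \<partial>\<eta> x \<partial>law t)"
    using wfun_measurable[OF g] by (subst nn_integral_law_Suc) auto
  also have "\<dots> = (\<integral>\<^sup>+x. ennreal (\<integral>y. g y \<partial>\<eta> x) \<partial>law t)"
  proof (rule nn_integral_cong)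
    fix x assume "x \<in> space (law t)"
    then have x: "x \<in> Z \<times> A" by (rule space_law_subset)
    show "(\<integral>\<^sup>+y. g y \<partial>\<eta> x) = ennreal (\<integral>y. g y \<partial>\<eta> x)"
      using g0 by (intro nn_integral_eq_integral wfun_integrable(1)[OF g x] AE_I2) (simp add: eta_space[OF x])
  qed
  also have "enn2real \<dots> = (\<integral>x. (\<integral>y. g y \<partial>\<eta> x) \<partial>law t)"
  proof (rule integral_eq_nn_integral[symmetric])
    show "(\<lambda>x. \<integral>y. g y \<partial>\<eta> x) \<in> borel_measurable (law t)"
      by (rule cont_law_measurable[OF eta_integral_continuous[OF g]])
    show "AE x in law t. 0 \<le> (\<integral>y. g y \<partial>\<eta> x)"
      using g0 eta_space space_law_subset(2)
      by (intro AE_I2 integral_nonneg_AE) (force simp del: space_law)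
  qed
  finally show ?thesis .
qed

text \<open>A signed \<open>u\<close> is shifted by \<open>K w\<close> so that the identity for nonnegative integrals applies, and the shift is subtracted
again.\<close>

lemma integral_law_Suc:
  assumes u: "wfun K u"
  shows "(\<integral>x. u (fst x) \<partial>law (Suc t)) = (\<integral>x. (\<integral>y. u y \<partial>\<eta> x) \<partial>law t)"
proof -
  let ?g = "\<lambda>y. u y + K * w y"
  have g: "wfun (2 * K) ?g"
    unfolding wfun_def
  proof (intro conjI ballI)
    show "continuous_on Z ?g" by (intro continuous_intros wfun_cont[OF u] w_cont)
    fix y assume "y \<in> Z"
    from wfun_le[OF u this] show "\<bar>?g y\<bar> \<le> 2 * K * w y" by linarith
  qed
  have g0: "0 \<le> ?g y" if "y \<in> Z" for y using wfun_le[OF u that] by linarith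
  have w0: "0 \<le> w y" if "y \<in> Z" for y using w_ge_1[OF that] by simp
  have "(\<integral>x. (\<integral>y. ?g y \<partial>\<eta> x) \<partial>law t) = (\<integral>x. (\<integral>y. u y \<partial>\<eta> x) + K * (\<integral>y. w y \<partial>\<eta> x) \<partial>law t)"
  proof (rule Bochner_Integration.integral_cong[OF refl])
    fix x assume "x \<in> space (law t)"
    then have x: "x \<in> Z \<times> A" by (rule space_law_subset)
    show "(\<integral>y. ?g y \<partial>\<eta> x) = (\<integral>y. u y \<partial>\<eta> x) + K * (\<integral>y. w y \<partial>\<eta> x)"
      using wfun_integrable(1)[OF u x] wfun_integrable(1)[OF wfun_w x] by simp
  qed
  then have "(\<integral>x. ?g (fst x) \<partial>law (Suc t))
      = (\<integral>x. (\<integral>y. u y \<partial>\<eta> x) \<partial>law t) + K * (\<integral>x. (\<integral>y. w y \<partial>\<eta> x) \<partial>law t)"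
    using integral_law_Suc_nonneg[OF g g0] eta_integral_law_integrable[OF u] eta_integral_law_integrable[OF wfun_w] by simp
  moreover have "(\<integral>x. ?g (fst x) \<partial>law (Suc t)) = (\<integral>x. u (fst x) \<partial>law (Suc t)) + K * (\<integral>x. w (fst x) \<partial>law (Suc t))"
    using wfun_law_integrable(1)[OF u] weight_integrable by simp
  ultimately show ?thesis
    using integral_law_Suc_nonneg[OF wfun_w w0] by simp
qed

definition stage_cost :: "nat \<Rightarrow> real" where "stage_cost t = (\<integral>x. c x \<partial>law t)"

lemma cost_law: "integrable (law t) c" "(\<integral>\<^sup>+x. c x \<partial>law t) = ennreal (stage_cost t)" "0 \<le> stage_cost t"
proof -
  have c0: "0 \<le> c x" and cM: "c x \<le> M * w (fst x)" if "x \<in> space (law t)" for x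
    using c_nonneg c_le space_law_subset(2)[OF that] by auto
  have i: "integrable (law t) (\<lambda>x. M * w (fst x))" using weight_integrable by simp
  show ic: "integrable (law t) c"
  proof (rule Bochner_Integration.integrable_bound[OF i cont_law_measurable[OF c_cont]])
    show "AE x in law t. norm (c x) \<le> norm (M * w (fst x))"
      by (intro AE_I2) (use c0 cM in force)
  qed
  show "(\<integral>\<^sup>+x. c x \<partial>law t) = ennreal (stage_cost t)"
    unfolding stage_cost_def using c0 by (intro nn_integral_eq_integral[OF ic] AE_I2)
  show "0 \<le> stage_cost t" unfolding stage_cost_def using c0 by (intro integral_nonneg_AE AE_I2)
qed

lemma average_cost_real:
  "average_cost Z B \<eta> c \<pi> z = limsup (\<lambda>T. ennreal (\<Sum>t<T. stage_cost t) / of_nat T)"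
proof -
  have "continuous_on (Z \<times> B) c" using c_cont B_subset by (rule_tac continuous_on_subset) auto
  then show ?thesis
    by (subst average_cost_eq[OF continuous_on_pair_measurable])
       (simp_all add: cost_law(2,3) sum_ennreal)
qed

lemma average_quotient: "0 < T \<Longrightarrow> ennreal (\<Sum>t<T. stage_cost t) / of_nat T = ennreal ((\<Sum>t<T. stage_cost t) / real T)"
  using cost_law(3) by (simp add: divide_ennreal sum_nonneg ennreal_of_nat_eq_real_of_nat)

text \<open>Integrating the hypothesis against the law at time \<open>t\<close> and summing over \<open>t < T\<close> makes the terms with \<open>h\<close>
telescope. What remains at the ends is bounded uniformly in \<open>T\<close> by the moment bound and disappears after division by
\<open>T\<close>.\<close>

lemma average_cost_le:
  assumes h: "wfun K h"
    and le: "\<And>t. AE x in law t. c x + (\<integral>y. h y \<partial>\<eta> x) \<le> \<rho> + h (fst x)"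
  shows "average_cost Z B \<eta> c \<pi> z \<le> ennreal \<rho>"
proof -
  let ?h = "\<lambda>t. \<integral>x. h (fst x) \<partial>law t"
  have step: "stage_cost t + ?h (Suc t) \<le> \<rho> + ?h t" for t
  proof -
    interpret P: prob_space "law t" by (rule prob_space_law)
    have "(\<integral>x. c x + (\<integral>y. h y \<partial>\<eta> x) \<partial>law t) \<le> (\<integral>x. \<rho> + h (fst x) \<partial>law t)"
      using cost_law(1) eta_integral_law_integrable[OF h] wfun_law_integrable(1)[OF h]
      by (intro integral_mono_AE le) auto
    then show ?thesis
      using cost_law(1) eta_integral_law_integrable[OF h] wfun_law_integrable(1)[OF h]
      by (simp add: stage_cost_def integral_law_Suc[OF h] P.prob_space del: space_law)
  qed
  have sum: "(\<Sum>t<T. stage_cost t) + ?h T \<le> \<rho> * real T + ?h 0" for T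
  proof (induction T)
    case (Suc T) then show ?case using step[of T] by (simp add: algebra_simps)
  qed simp
  have le': "(\<Sum>t<T. stage_cost t) / real T \<le> \<rho> + 2 * (K * moment_bound) / real T" if "0 < T" for T
  proof -
    have "(\<Sum>t<T. stage_cost t) \<le> \<rho> * real T + 2 * (K * moment_bound)"
      using sum[of T] wfun_law_integrable(2)[OF h, of T] wfun_law_integrable(2)[OF h, of 0] by linarith
    then have "(\<Sum>t<T. stage_cost t) / real T \<le> (\<rho> * real T + 2 * (K * moment_bound)) / real T"
      by (intro divide_right_mono) auto
    then show ?thesis using that by (simp add: add_divide_distrib)
  qed
  have "average_cost Z B \<eta> c \<pi> z \<le> limsup (\<lambda>T. ennreal (\<rho> + 2 * (K * moment_bound) / real T))"
    unfolding average_cost_real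
  proof (rule Limsup_mono)
    show "eventually (\<lambda>T. ennreal (\<Sum>t<T. stage_cost t) / of_nat T \<le> ennreal (\<rho> + 2 * (K * moment_bound) / real T)) sequentially"
      using eventually_gt_at_top[of 0]
      by eventually_elim (simp add: average_quotient ennreal_leI le')
  qed
  also have "\<dots> = ennreal \<rho>"
  proof (rule lim_imp_Limsup)
    have "(\<lambda>T. \<rho> + 2 * (K * moment_bound) / real T) \<longlonglongrightarrow> \<rho> + 0"
      by (intro tendsto_intros lim_const_over_n)
    then show "(\<lambda>T. ennreal (\<rho> + 2 * (K * moment_bound) / real T)) \<longlonglongrightarrow> ennreal \<rho>"
      by (intro tendsto_ennrealI) simp
  qed simp
  finally show ?thesis .
qed

lemma average_cost_ge:
  assumes h: "wfun K h"
    and le: "\<And>x. x \<in> Z \<times> B \<Longrightarrow> \<rho> + h (fst x) \<le> c x + (\<integral>y. h y \<partial>\<eta> x)"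
  shows "ennreal \<rho> \<le> average_cost Z B \<eta> c \<pi> z"
proof -
  let ?h = "\<lambda>t. \<integral>x. h (fst x) \<partial>law t"
  have step: "\<rho> + ?h t \<le> stage_cost t + ?h (Suc t)" for t
  proof -
    interpret P: prob_space "law t" by (rule prob_space_law)
    have "(\<integral>x. \<rho> + h (fst x) \<partial>law t) \<le> (\<integral>x. c x + (\<integral>y. h y \<partial>\<eta> x) \<partial>law t)"
      using cost_law(1) eta_integral_law_integrable[OF h] wfun_law_integrable(1)[OF h] space_law_subset(1)
      by (intro integral_mono le) (auto simp del: space_law)
    then show ?thesis
      using cost_law(1) eta_integral_law_integrable[OF h] wfun_law_integrable(1)[OF h]
      by (simp add: stage_cost_def integral_law_Suc[OF h] P.prob_space del: space_law)
  qed
  have sum: "\<rho> * real T + ?h 0 \<le> (\<Sum>t<T. stage_cost t) + ?h T" for T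
  proof (induction T)
    case (Suc T) then show ?case using step[of T] by (simp add: algebra_simps)
  qed simp
  have le': "\<rho> - 2 * (K * moment_bound) / real T \<le> (\<Sum>t<T. stage_cost t) / real T" if "0 < T" for T
  proof -
    have "\<rho> * real T - 2 * (K * moment_bound) \<le> (\<Sum>t<T. stage_cost t)"
      using sum[of T] wfun_law_integrable(2)[OF h, of T] wfun_law_integrable(2)[OF h, of 0] by linarith
    then have "(\<rho> * real T - 2 * (K * moment_bound)) / real T \<le> (\<Sum>t<T. stage_cost t) / real T"
      by (intro divide_right_mono) auto
    then show ?thesis using that by (simp add: diff_divide_distrib)
  qed
  have "ennreal \<rho> = limsup (\<lambda>T. ennreal (\<rho> - 2 * (K * moment_bound) / real T))"
  proof (rule lim_imp_Limsup[symmetric])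
    have "(\<lambda>T. \<rho> - 2 * (K * moment_bound) / real T) \<longlonglongrightarrow> \<rho> - 0"
      by (intro tendsto_intros lim_const_over_n)
    then show "(\<lambda>T. ennreal (\<rho> - 2 * (K * moment_bound) / real T)) \<longlonglongrightarrow> ennreal \<rho>"
      by (intro tendsto_ennrealI) simp
  qed simp
  also have "\<dots> \<le> average_cost Z B \<eta> c \<pi> z"
    unfolding average_cost_real
  proof (rule Limsup_mono)
    show "eventually (\<lambda>T. ennreal (\<rho> - 2 * (K * moment_bound) / real T) \<le> ennreal (\<Sum>t<T. stage_cost t) / of_nat T) sequentially"
      using eventually_gt_at_top[of 0]
      by eventually_elim (simp add: average_quotient ennreal_leI le')
  qed
  finally show ?thesis .
qed

end

context weighted_mdp begin

lemma average_cost_value_ge: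
  assumes "B \<subseteq> A" "z \<in> Z" and h: "wfun K h"
    and le: "\<And>x. x \<in> Z \<times> B \<Longrightarrow> \<rho> + h (fst x) \<le> c x + (\<integral>y. h y \<partial>\<eta> x)"
  shows "ennreal \<rho> \<le> average_cost_value Z B \<eta> c z"
  unfolding average_cost_value_def
proof (rule INF_greatest)
  fix \<pi> assume "\<pi> \<in> policies Z B"
  then interpret weighted_mdp_policy Z A \<eta> c M \<alpha> w \<nu> \<phi> B \<pi> z
    using restricted_kernel assms by unfold_locales auto
  show "ennreal \<rho> \<le> average_cost Z B \<eta> c \<pi> z" by (rule average_cost_ge[OF h le])
qed

text \<open>The infimum over actions need not be attained by a measurable selector, so a margin \<open>e\<close> is allowed in the selection and
removed at the end.\<close>

lemma average_cost_value_le: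
  assumes B: "B \<subseteq> A" "B \<noteq> {}" and z: "z \<in> Z" and h: "wfun K h"
    and le: "\<And>y. y \<in> Z \<Longrightarrow> (INF a\<in>B. c (y, a) + (\<integral>y'. h y' \<partial>\<eta> (y, a))) \<le> \<rho> + h y"
  shows "average_cost_value Z B \<eta> c z \<le> ennreal \<rho>"
proof -
  have "average_cost_value Z B \<eta> c z \<le> ennreal (\<rho> + e)" if "0 < e" for e
  proof -
    let ?g = "\<lambda>x. c x + (\<integral>y'. h y' \<partial>\<eta> x)"
    have gA: "continuous_on (Z \<times> A) ?g"
      by (intro continuous_intros c_cont eta_integral_continuous[OF h])
    have gB: "continuous_on (Z \<times> B) ?g"
      by (rule continuous_on_subset[OF gA]) (use B in auto)
    have ex: "\<exists>a\<in>B. ?g (y, a) < \<rho> + e + h y" if "y \<in> Z" for y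
    proof (rule ccontr)
      assume "\<not> ?thesis"
      then have "\<rho> + e + h y \<le> (INF a\<in>B. ?g (y, a))"
        by (intro cINF_greatest[OF B(2)]) (auto simp: not_less)
      then show False using le[OF that] \<open>0 < e\<close> by simp
    qed
    have "continuous_on Z (\<lambda>y. \<rho> + e + h y)" by (intro continuous_intros wfun_cont[OF h])
    from measurable_selection_strict[OF B(2) gB this ex]
    obtain f where f: "f \<in> borel_on Z \<rightarrow>\<^sub>M borel_on B"
      and fle: "\<And>y. y \<in> Z \<Longrightarrow> ?g (y, f y) < \<rho> + e + h y" by blast
    define \<pi> :: "nat \<Rightarrow> (nat \<Rightarrow> 'z \<times> 'a) \<times> 'z \<Rightarrow> 'a measure"
      where "\<pi> t p = return (borel_on B) (f (snd p))" for t p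
    have \<pi>: "\<pi> \<in> policies Z B"
      unfolding policies_def history_space_def \<pi>_def[abs_def]
      by (auto intro!: measurable_compose[OF measurable_compose[OF measurable_snd f] measurable_return_prob_space])
    interpret weighted_mdp_policy Z A \<eta> c M \<alpha> w \<nu> \<phi> B \<pi> z
      using restricted_kernel \<pi> z B by unfold_locales auto
    have "average_cost Z B \<eta> c \<pi> z \<le> ennreal (\<rho> + e)"
    proof (rule average_cost_le[OF h])
      fix t
      have [measurable]: "?g \<in> borel_measurable (borel_on Z \<Otimes>\<^sub>M borel_on B)"
        by (rule continuous_on_pair_measurable[OF gB])
      have [measurable]: "h \<in> borel_measurable (borel_on Z)" by (rule wfun_measurable[OF h])
      show "AE x in law t. ?g x \<le> \<rho> + e + h (fst x)"
      proof (rule AE_law_stationary[OF f])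
        show "\<pi> t (p, y) = return (borel_on B) (f y)" for p y by (simp add: \<pi>_def)
        show "Measurable.pred (borel_on Z \<Otimes>\<^sub>M borel_on B) (\<lambda>x. ?g x \<le> \<rho> + e + h (fst x))"
          by measurable
      qed (use fle in force)
    qed
    then show ?thesis
      unfolding average_cost_value_def by (rule INF_lower2[OF \<pi>])
  qed
  then have "eventually (\<lambda>e. average_cost_value Z B \<eta> c z \<le> ennreal (\<rho> + e)) (at_right 0)"
    by (auto simp: eventually_at_right_less eventually_at_filter)
  moreover have "((\<lambda>e. ennreal (\<rho> + e)) \<longlongrightarrow> ennreal (\<rho> + 0)) (at_right 0)"
    by (intro tendsto_ennrealI tendsto_intros)
  ultimately show ?thesis
    by (intro tendsto_lowerbound[where F="at_right (0::real)"]) auto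
qed

end

section \<open>The fixed point of the killed Bellman operator\<close>

context weighted_mdp begin

definition action_family :: "'a set set \<Rightarrow> bool" where
  "action_family F \<longleftrightarrow> F \<noteq> {} \<and> (\<forall>B\<in>F. B \<noteq> {} \<and> B \<subseteq> A)"

lemma action_familyD: "action_family F \<Longrightarrow> F \<noteq> {}" "action_family F \<Longrightarrow> B \<in> F \<Longrightarrow> B \<noteq> {} \<and> B \<subseteq> A"
  by (auto simp: action_family_def)

lemma action_family_singleton: "B \<noteq> {} \<Longrightarrow> B \<subseteq> A \<Longrightarrow> action_family {B}"
  by (auto simp: action_family_def)

definition bellman :: "'a set set \<Rightarrow> real \<Rightarrow> ('z \<Rightarrow> real) \<Rightarrow> 'z \<Rightarrow> real" where
  "bellman F \<rho> u z = minimax F (\<lambda>a. Q \<rho> u (z, a))"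

lemma bellman_mono:
  assumes F: "action_family F" and G: "action_family G" and ref: "\<And>B. B \<in> F \<Longrightarrow> \<exists>B'\<in>G. B' \<subseteq> B"
    and u: "wfun K u" and v: "wfun K' v" and z: "z \<in> Z"
    and "0 \<le> k" and le: "\<And>y. y \<in> Z \<Longrightarrow> u y \<le> v y + k * w y"
  shows "bellman F \<rho> u z \<le> bellman G \<rho> v z + \<alpha> * k * w z"
  unfolding bellman_def
proof (rule minimax_mono[where A=A, OF action_familyD(1)[OF F] action_familyD(2)[OF G] ref])
  show "B \<subseteq> A" if "B \<in> F" for B using action_familyD(2)[OF F that] by simp
  show "\<bar>Q \<rho> u (z, a)\<bar> \<le> (M + \<bar>\<rho>\<bar> + \<alpha> * K) * w z" "\<bar>Q \<rho> v (z, a)\<bar> \<le> (M + \<bar>\<rho>\<bar> + \<alpha> * K') * w z"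
    if "a \<in> A" for a
    using Q_bound[OF u z that] Q_bound[OF v z that] .
  show "Q \<rho> u (z, a) \<le> Q \<rho> v (z, a) + \<alpha> * k * w z" if "a \<in> A" for a
    by (rule Q_mono[OF u v z that \<open>0 \<le> k\<close> le])
qed

lemma bellman_contraction:
  assumes F: "action_family F" and u: "wfun K u" and v: "wfun K' v" and z: "z \<in> Z"
    and "0 \<le> k" and le: "\<And>y. y \<in> Z \<Longrightarrow> \<bar>u y - v y\<bar> \<le> k * w y"
  shows "\<bar>bellman F \<rho> u z - bellman F \<rho> v z\<bar> \<le> \<alpha> * k * w z"
proof -
  have "bellman F \<rho> u z \<le> bellman F \<rho> v z + \<alpha> * k * w z"
  proof (rule bellman_mono[OF F F _ u v z \<open>0 \<le> k\<close>])
    show "u y \<le> v y + k * w y" if "y \<in> Z" for y using le[OF that] by linarith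
  qed blast
  moreover have "bellman F \<rho> v z \<le> bellman F \<rho> u z + \<alpha> * k * w z"
  proof (rule bellman_mono[OF F F _ v u z \<open>0 \<le> k\<close>])
    show "v y \<le> u y + k * w y" if "y \<in> Z" for y using le[OF that] by linarith
  qed blast
  ultimately show ?thesis by linarith
qed

text \<open>Continuity in the state: by compactness of \<open>A\<close> the function \<open>Q\<close> changes little in the state uniformly over all actions,
and a uniform change of \<open>Q\<close> changes the minimax value by no more, whatever the family \<open>F\<close> is.\<close>

lemma wfun_bellman:
  assumes F: "action_family F" and u: "wfun K u"
  shows "wfun (M + \<bar>\<rho>\<bar> + \<alpha> * K) (bellman F \<rho> u)"
  unfolding wfun_def
proof (intro conjI ballI)
  fix z assume z: "z \<in> Z"
  show "\<bar>bellman F \<rho> u z\<bar> \<le> (M + \<bar>\<rho>\<bar> + \<alpha> * K) * w z"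
    unfolding bellman_def by (rule abs_minimax_le(2)[where A=A]) (use action_familyD[OF F] Q_bound[OF u z] in auto)
next
  show "continuous_on Z (bellman F \<rho> u)"
    unfolding continuous_on_iff
  proof (intro ballI allI impI)
    fix z0 and e :: real assume z0: "z0 \<in> Z" and e: "0 < e"
    obtain X where X: "z0 \<in> X" "open X"
      "\<forall>z\<in>X \<inter> Z. \<forall>a\<in>A. dist (Q \<rho> u (z, a)) (Q \<rho> u (z0, a)) \<le> e / 2"
      by (rule continuous_on_prod_compactE[OF Q_continuous[OF u, of \<rho>] A_compact z0, of "e / 2"]) (use e in auto)
    from openE[OF X(2,1)] obtain d where d: "0 < d" "ball z0 d \<subseteq> X" by blast
    show "\<exists>d>0. \<forall>z\<in>Z. dist z z0 < d \<longrightarrow> dist (bellman F \<rho> u z) (bellman F \<rho> u z0) < e"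
    proof (intro exI[of _ d] conjI d(1) ballI impI)
      fix z assume z: "z \<in> Z" and "dist z z0 < d"
      then have "z \<in> X" using d(2) by (auto simp: dist_commute)
      then have near: "\<bar>Q \<rho> u (z, a) - Q \<rho> u (z0, a)\<bar> \<le> e / 2" if "a \<in> A" for a
        using X(3) z that by (auto simp: dist_real_def)
      have B: "B \<subseteq> A" if "B \<in> F" for B using action_familyD(2)[OF F that] by simp
      have "bellman F \<rho> u z \<le> bellman F \<rho> u z0 + e / 2"
        unfolding bellman_def
      proof (rule minimax_mono[where A=A, OF action_familyD(1)[OF F] action_familyD(2)[OF F] _ B Q_bound[OF u z] Q_bound[OF u z0]])
        fix a assume "a \<in> A" from near[OF this] show "Q \<rho> u (z, a) \<le> Q \<rho> u (z0, a) + e / 2" by linarith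
      qed blast+
      moreover have "bellman F \<rho> u z0 \<le> bellman F \<rho> u z + e / 2"
        unfolding bellman_def
      proof (rule minimax_mono[where A=A, OF action_familyD(1)[OF F] action_familyD(2)[OF F] _ B Q_bound[OF u z0] Q_bound[OF u z]])
        fix a assume "a \<in> A" from near[OF this] show "Q \<rho> u (z0, a) \<le> Q \<rho> u (z, a) + e / 2" by linarith
      qed blast+
      ultimately show "dist (bellman F \<rho> u z) (bellman F \<rho> u z0) < e"
        using e by (simp add: dist_real_def)
    qed
  qed
qed

text \<open>The solution of \<open>M + \<bar>\<rho>\<bar> + \<alpha> K = K\<close>, so that the functions of \<open>w\<close>-norm at most \<open>radius \<rho>\<close> are mapped to
themselves.\<close>

definition radius :: "real \<Rightarrow> real" where "radius \<rho> = (M + \<bar>\<rho>\<bar>) / (1 - \<alpha>)"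

lemma radius_nonneg: "0 \<le> radius \<rho>"
  using M_nonneg alpha by (simp add: radius_def)

lemma radius_eq: "M + \<bar>\<rho>\<bar> + \<alpha> * radius \<rho> = radius \<rho>"
  using alpha by (simp add: radius_def field_simps)

definition iterate :: "'a set set \<Rightarrow> real \<Rightarrow> nat \<Rightarrow> 'z \<Rightarrow> real" where
  "iterate F \<rho> k = (bellman F \<rho> ^^ k) (\<lambda>_. 0)"

lemma iterate_simps: "iterate F \<rho> 0 = (\<lambda>_. 0)" "iterate F \<rho> (Suc k) = bellman F \<rho> (iterate F \<rho> k)"
  by (simp_all add: iterate_def)

lemma wfun_iterate:
  assumes F: "action_family F" shows "wfun (radius \<rho>) (iterate F \<rho> k)"
proof (induction k)
  case 0
  have "0 \<le> radius \<rho> * w z" if "z \<in> Z" for z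
    using radius_nonneg w_ge_1[OF that] by simp
  then show ?case by (simp add: wfun_def iterate_simps)
next
  case (Suc k)
  from wfun_bellman[OF F Suc, of \<rho>] show ?case by (simp add: radius_eq iterate_simps)
qed

lemma iterate_diff:
  assumes F: "action_family F" and z: "z \<in> Z"
  shows "\<bar>iterate F \<rho> (k + j) z - iterate F \<rho> k z\<bar> \<le> \<alpha> ^ k * radius \<rho> * w z"
  using z
proof (induction k arbitrary: z)
  case 0
  then show ?case using wfun_le[OF wfun_iterate[OF F, of \<rho> j]] by (simp add: iterate_simps)
next
  case (Suc k)
  have "\<bar>bellman F \<rho> (iterate F \<rho> (k + j)) z - bellman F \<rho> (iterate F \<rho> k) z\<bar> \<le> \<alpha> * (\<alpha> ^ k * radius \<rho>) * w z"
    using alpha radius_nonneg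
    by (intro bellman_contraction[OF F wfun_iterate[OF F] wfun_iterate[OF F] Suc.prems] Suc.IH) simp
  then show ?case by (simp add: iterate_simps mult.assoc)
qed

text \<open>The optimal total cost, with charge \<open>\<rho>\<close> per step, until the killing time, in the game in which the adversary chooses an
action set from \<open>F\<close> at each step.\<close>

definition killed_value :: "'a set set \<Rightarrow> real \<Rightarrow> 'z \<Rightarrow> real" where
  "killed_value F \<rho> z = lim (\<lambda>k. iterate F \<rho> k z)"

lemma geometric_vanishes: "(\<lambda>k. \<alpha> ^ k * C) \<longlonglongrightarrow> 0"
  using alpha by (intro tendsto_mult_left_zero LIMSEQ_realpow_zero) auto

lemma iterate_limit:
  assumes F: "action_family F" and z: "z \<in> Z"
  shows "(\<lambda>k. iterate F \<rho> k z) \<longlonglongrightarrow> killed_value F \<rho> z"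
proof -
  have "Cauchy (\<lambda>k. iterate F \<rho> k z)"
    unfolding Cauchy_altdef
  proof (intro allI impI)
    fix e :: real assume "0 < e"
    with geometric_vanishes[of "radius \<rho> * w z"]
    have "eventually (\<lambda>k. \<alpha> ^ k * (radius \<rho> * w z) < e) sequentially" by (rule order_tendstoD)
    then obtain N where N: "\<And>k. k \<ge> N \<Longrightarrow> \<alpha> ^ k * (radius \<rho> * w z) < e"
      by (auto simp: eventually_sequentially)
    show "\<exists>N. \<forall>m\<ge>N. \<forall>n>m. dist (iterate F \<rho> m z) (iterate F \<rho> n z) < e"
    proof (intro exI[of _ N] allI impI)
      fix m n assume "m \<ge> N" "n > m"
      then show "dist (iterate F \<rho> m z) (iterate F \<rho> n z) < e"
        using N[of m] iterate_diff[OF F z, of \<rho> m "n - m"]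
        by (simp add: dist_real_def abs_minus_commute mult.assoc)
    qed
  qed
  then show ?thesis
    unfolding killed_value_def by (simp add: Cauchy_convergent_iff convergent_LIMSEQ_iff)
qed

lemma killed_value_diff:
  assumes F: "action_family F" and z: "z \<in> Z"
  shows "\<bar>killed_value F \<rho> z - iterate F \<rho> k z\<bar> \<le> \<alpha> ^ k * radius \<rho> * w z"
proof (rule tendsto_upperbound)
  have "(\<lambda>j. iterate F \<rho> (j + k) z) \<longlonglongrightarrow> killed_value F \<rho> z"
    by (rule LIMSEQ_ignore_initial_segment[OF iterate_limit[OF F z]])
  then show "(\<lambda>j. \<bar>iterate F \<rho> (k + j) z - iterate F \<rho> k z\<bar>) \<longlonglongrightarrow> \<bar>killed_value F \<rho> z - iterate F \<rho> k z\<bar>"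
    by (intro tendsto_intros) (simp add: add.commute)
qed (use iterate_diff[OF F z] in auto)

text \<open>The iterates converge uniformly after division by \<open>w\<close>, so the limit is continuous.\<close>

lemma wfun_killed_value:
  assumes F: "action_family F" shows "wfun (radius \<rho>) (killed_value F \<rho>)"
  unfolding wfun_def
proof (intro conjI ballI)
  show "\<bar>killed_value F \<rho> z\<bar> \<le> radius \<rho> * w z" if "z \<in> Z" for z
    using killed_value_diff[OF F that, of \<rho> 0] by (simp add: iterate_simps)
  have "uniform_limit Z (\<lambda>k z. iterate F \<rho> k z / w z) (\<lambda>z. killed_value F \<rho> z / w z) sequentially"
  proof (rule uniform_limitI)
    fix e :: real assume "0 < e"
    with geometric_vanishes[of "radius \<rho>"]
    have "eventually (\<lambda>k. \<alpha> ^ k * radius \<rho> < e) sequentially" by (rule order_tendstoD)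
    then show "eventually (\<lambda>k. \<forall>z\<in>Z. dist (iterate F \<rho> k z / w z) (killed_value F \<rho> z / w z) < e) sequentially"
    proof eventually_elim
      case (elim k)
      show ?case
      proof
        fix z assume z: "z \<in> Z"
        have w0: "0 < w z" using w_ge_1[OF z] by simp
        have "dist (iterate F \<rho> k z / w z) (killed_value F \<rho> z / w z) = \<bar>killed_value F \<rho> z - iterate F \<rho> k z\<bar> / w z"
          using w0 by (simp add: dist_real_def diff_divide_distrib[symmetric] abs_minus_commute)
        also have "\<dots> \<le> \<alpha> ^ k * radius \<rho>"
          using killed_value_diff[OF F z, of \<rho> k] w0 by (simp add: divide_le_eq)
        finally show "dist (iterate F \<rho> k z / w z) (killed_value F \<rho> z / w z) < e" using elim by simp
      qed
    qed
  qed
  moreover have "eventually (\<lambda>k. continuous_on Z (\<lambda>z. iterate F \<rho> k z / w z)) sequentially"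
  proof -
    have "continuous_on Z (\<lambda>z. iterate F \<rho> k z / w z)" for k
      using w_ge_1 by (intro continuous_on_divide wfun_cont[OF wfun_iterate[OF F]] w_cont) force
    then show ?thesis by simp
  qed
  ultimately have "continuous_on Z (\<lambda>z. killed_value F \<rho> z / w z)"
    by (intro uniform_limit_theorem) auto
  then have "continuous_on Z (\<lambda>z. killed_value F \<rho> z / w z * w z)"
    by (intro continuous_on_mult w_cont)
  moreover have "killed_value F \<rho> z / w z * w z = killed_value F \<rho> z" if "z \<in> Z" for z
    using w_ge_1[OF that] by simp
  ultimately show "continuous_on Z (killed_value F \<rho>)"
    by (rule continuous_on_eq)
qed

lemma killed_value_fixed:
  assumes F: "action_family F" and z: "z \<in> Z"
  shows "bellman F \<rho> (killed_value F \<rho>) z = killed_value F \<rho> z"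
proof -
  let ?v = "killed_value F \<rho>"
  have "\<bar>bellman F \<rho> ?v z - ?v z\<bar> \<le> \<alpha> ^ k * (2 * radius \<rho> * w z)" for k
  proof -
    have "\<bar>bellman F \<rho> ?v z - bellman F \<rho> (iterate F \<rho> k) z\<bar> \<le> \<alpha> * (\<alpha> ^ k * radius \<rho>) * w z"
      using alpha radius_nonneg
      by (intro bellman_contraction[OF F wfun_killed_value[OF F] wfun_iterate[OF F] z] killed_value_diff[OF F]) simp
    also have "\<dots> \<le> \<alpha> ^ k * radius \<rho> * w z"
      using alpha radius_nonneg w_ge_1[OF z] by (simp add: mult.assoc mult_left_le_one_le)
    finally have 1: "\<bar>bellman F \<rho> ?v z - iterate F \<rho> (Suc k) z\<bar> \<le> \<alpha> ^ k * radius \<rho> * w z"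
      by (simp add: iterate_simps)
    have "\<bar>?v z - iterate F \<rho> (Suc k) z\<bar> \<le> \<alpha> ^ Suc k * radius \<rho> * w z" by (rule killed_value_diff[OF F z])
    also have "\<dots> \<le> \<alpha> ^ k * radius \<rho> * w z"
      using alpha radius_nonneg w_ge_1[OF z] by (simp add: mult.assoc mult_left_le_one_le)
    finally show ?thesis using 1 by (simp add: algebra_simps)
  qed
  then have "\<bar>bellman F \<rho> ?v z - ?v z\<bar> \<le> 0"
    by (intro tendsto_lowerbound[OF geometric_vanishes] always_eventually allI) auto
  then show ?thesis by simp
qed

lemma iterate_mono:
  assumes F: "action_family F" and G: "action_family G" and ref: "\<And>B. B \<in> F \<Longrightarrow> \<exists>B'\<in>G. B' \<subseteq> B"
    and z: "z \<in> Z"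
  shows "iterate F \<rho> k z \<le> iterate G \<rho> k z"
  using z
proof (induction k arbitrary: z)
  case (Suc k)
  have "bellman F \<rho> (iterate F \<rho> k) z \<le> bellman G \<rho> (iterate G \<rho> k) z + \<alpha> * 0 * w z"
    by (rule bellman_mono[OF F G ref wfun_iterate[OF F] wfun_iterate[OF G] Suc.prems]) (use Suc.IH in auto)
  then show ?case by (simp add: iterate_simps)
qed (simp add: iterate_simps)

lemma killed_value_mono:
  assumes F: "action_family F" and G: "action_family G" and ref: "\<And>B. B \<in> F \<Longrightarrow> \<exists>B'\<in>G. B' \<subseteq> B"
    and z: "z \<in> Z"
  shows "killed_value F \<rho> z \<le> killed_value G \<rho> z"
  by (rule LIMSEQ_le[OF iterate_limit[OF F z] iterate_limit[OF G z]])
     (use iterate_mono[OF F G ref z] in auto)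

lemma killed_value_nonneg:
  assumes B: "B \<noteq> {}" "B \<subseteq> A" and z: "z \<in> Z"
  shows "0 \<le> killed_value {B} 0 z"
proof (rule LIMSEQ_le_const[OF iterate_limit[OF action_family_singleton[OF B] z]])
  note F = action_family_singleton[OF B]
  have "0 \<le> iterate {B} 0 k y" if "y \<in> Z" for k y
    using that
  proof (induction k arbitrary: y)
    case (Suc k)
    have z0: "wfun 0 (\<lambda>_. 0)" by (simp add: wfun_def)
    have "0 \<le> Q 0 (iterate {B} 0 k) (y, a)" if "a \<in> B" for a
    proof -
      have a: "a \<in> A" using that B by auto
      have "Q 0 (\<lambda>_. 0) (y, a) \<le> Q 0 (iterate {B} 0 k) (y, a) + \<alpha> * 0 * w y"
        by (rule Q_mono[OF z0 wfun_iterate[OF F] Suc.prems a]) (use Suc.IH in auto)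
      then show ?thesis using c_nonneg[OF Suc.prems a] by (simp add: Q_def)
    qed
    then show ?case
      by (auto simp: iterate_simps bellman_def minimax_def intro!: cINF_greatest B(1))
  qed (simp add: iterate_simps)
  then show "\<exists>N. \<forall>k\<ge>N. 0 \<le> iterate {B} 0 k z" using z by blast
qed

lemma killed_value_singleton:
  assumes B: "B \<noteq> {}" "B \<subseteq> A" and z: "z \<in> Z"
  shows "killed_value {B} \<rho> z = (INF a\<in>B. Q \<rho> (killed_value {B} \<rho>) (z, a))"
  using killed_value_fixed[OF action_family_singleton[OF B] z, of \<rho>]
  by (simp add: bellman_def minimax_def)

section \<open>The gain of an action set\<close>

text \<open>If the killed cost has nonnegative mean under \<open>\<nu>\<close>, dropping the term \<open>\<nu>(h) \<phi>\<close> from the fixed point equation only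
weakens it, and an inequality valid for all actions in \<open>B\<close> is inherited by every smaller action set \<open>B'\<close>.\<close>

lemma value_ge_if_mean_nonneg:
  assumes B: "B \<noteq> {}" "B \<subseteq> A" and "B' \<subseteq> B" and z: "z \<in> Z"
    and pos: "0 \<le> (\<integral>y. killed_value {B} \<rho> y \<partial>\<nu>)"
  shows "ennreal \<rho> \<le> average_cost_value Z B' \<eta> c z"
proof (rule average_cost_value_ge[OF _ z wfun_killed_value[OF action_family_singleton[OF B], of \<rho>]])
  let ?h = "killed_value {B} \<rho>"
  show "B' \<subseteq> A" using assms by auto
  fix x assume "x \<in> Z \<times> B'"
  then obtain y a where x: "x = (y, a)" "y \<in> Z" "a \<in> B" using assms by auto
  have aA: "a \<in> A" using x B by auto
  have "bdd_below ((\<lambda>a. Q \<rho> ?h (y, a)) ` B)"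
    by (rule abs_INF_le(1)[OF B(1) Q_bound[OF wfun_killed_value[OF action_family_singleton[OF B]] x(2)]])
       (use B in auto)
  then have "?h y \<le> Q \<rho> ?h (y, a)"
    by (subst killed_value_singleton[OF B x(2)]) (rule cINF_lower[OF _ x(3)])
  moreover have "0 \<le> (\<integral>y. ?h y \<partial>\<nu>) * \<phi> (y, a)"
    using pos phi_nonneg[OF x(2) aA] by simp
  ultimately show "\<rho> + ?h (fst x) \<le> c x + (\<integral>y. ?h y \<partial>\<eta> x)"
    by (simp add: x(1) Q_def)
qed

lemma value_le_if_mean_nonpos:
  assumes B: "B \<noteq> {}" "B \<subseteq> A" and z: "z \<in> Z"
    and neg: "(\<integral>y. killed_value {B} \<rho> y \<partial>\<nu>) \<le> 0"
  shows "average_cost_value Z B \<eta> c z \<le> ennreal \<rho>"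
proof (rule average_cost_value_le[OF B(2,1) z wfun_killed_value[OF action_family_singleton[OF B], of \<rho>]])
  let ?h = "killed_value {B} \<rho>"
  fix y assume y: "y \<in> Z"
  let ?g = "\<lambda>a. c (y, a) + (\<integral>y'. ?h y' \<partial>\<eta> (y, a))"
  have le: "?g a - \<rho> \<le> Q \<rho> ?h (y, a)" if "a \<in> B" for a
  proof -
    have "0 \<le> \<phi> (y, a)" using phi_nonneg[OF y] that B by auto
    then have "(\<integral>y. ?h y \<partial>\<nu>) * \<phi> (y, a) \<le> 0" using neg by (simp add: mult_nonpos_nonneg)
    then show ?thesis by (simp add: Q_def)
  qed
  have "(INF a\<in>B. ?g a) - \<rho> \<le> (INF a\<in>B. Q \<rho> ?h (y, a))"
  proof (rule cINF_greatest[OF B(1)])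
    fix a assume a: "a \<in> B"
    have "bdd_below (?g ` B)"
    proof (rule bdd_belowI2)
      fix b assume b: "b \<in> B"
      have bA: "b \<in> A" using b B by auto
      have "?g b = Q 0 ?h (y, b) + (\<integral>y. ?h y \<partial>\<nu>) * \<phi> (y, b)" by (simp add: Q_def)
      moreover have "\<bar>(\<integral>y. ?h y \<partial>\<nu>) * \<phi> (y, b)\<bar> \<le> \<bar>\<integral>y. ?h y \<partial>\<nu>\<bar>"
        using phi_nonneg[OF y bA] phi_le_1[of "(y, b)"] y bA by (simp add: abs_mult mult_left_le)
      ultimately show "- (M + \<bar>0\<bar> + \<alpha> * radius \<rho>) * w y - \<bar>\<integral>y. ?h y \<partial>\<nu>\<bar> \<le> ?g b"
        using Q_bound[OF wfun_killed_value[OF action_family_singleton[OF B], of \<rho>] y bA, of 0]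
        unfolding abs_le_iff minus_mult_left[symmetric] by linarith
    qed
    from cINF_lower[OF this a] le[OF a] show "(INF a\<in>B. ?g a) - \<rho> \<le> Q \<rho> ?h (y, a)" by linarith
  qed
  then show "(INF a\<in>B. ?g a) \<le> \<rho> + ?h y"
    using killed_value_singleton[OF B y, of \<rho>] by linarith
qed

text \<open>A multiple of \<open>w\<close> itself satisfies the verification inequality. This crude bound keeps the supremum in the definition of
the gain finite.\<close>

lemma value_le_weight:
  assumes B: "B \<noteq> {}" "B \<subseteq> A" and z: "z \<in> Z"
  shows "average_cost_value Z B \<eta> c z \<le> ennreal (radius 0 * w_mean)"
proof -
  have R: "0 \<le> radius 0" by (rule radius_nonneg)
  have "wfun (radius 0) (\<lambda>y. radius 0 * w y)"
    unfolding wfun_def using R w_ge_1 by (auto intro!: continuous_intros w_cont simp: abs_mult)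
       (smt (verit) mult_left_mono)
  then show ?thesis
  proof (rule average_cost_value_le[OF B(2,1) z])
    fix y assume y: "y \<in> Z"
    let ?g = "\<lambda>a. c (y, a) + (\<integral>y'. radius 0 * w y' \<partial>\<eta> (y, a))"
    have bdd: "bdd_below (?g ` B)"
    proof (rule bdd_belowI2)
      fix a assume "a \<in> B"
      then have a: "a \<in> A" using B by auto
      have "0 \<le> (\<integral>y'. w y' \<partial>\<eta> (y, a))"
        using w_ge_1 eta_space[of "(y, a)"] y a by (intro integral_nonneg_AE AE_I2) force
      then show "0 \<le> ?g a" using R c_nonneg[OF y a] by simp
    qed
    obtain a where aB: "a \<in> B" using B by auto
    then have a: "a \<in> A" using B by auto
    have "(\<integral>y'. w y' \<partial>\<eta> (y, a)) \<le> \<alpha> * w y + w_mean"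
      using drift[OF y a] mult_left_mono[OF phi_le_1 w_mean_nonneg, of "(y, a)"] y a by simp
    then have "radius 0 * (\<integral>y'. w y' \<partial>\<eta> (y, a)) \<le> radius 0 * (\<alpha> * w y + w_mean)"
      using R by (rule mult_left_mono)
    then have "?g a \<le> (M + \<alpha> * radius 0) * w y + radius 0 * w_mean"
      using c_le[OF y a] by (simp add: algebra_simps)
    also have "M + \<alpha> * radius 0 = radius 0" using radius_eq[of 0] by simp
    finally show "(INF a\<in>B. ?g a) \<le> radius 0 * w_mean + radius 0 * w y"
      using cINF_lower[OF bdd aB] by linarith
  qed
qed

text \<open>The critical charge per step: any larger one makes the optimal killed cost negative in the mean when the process starts
from \<open>\<nu>\<close>.\<close>

definition gain :: "'a set \<Rightarrow> real" where
  "gain B = Sup {\<rho>. 0 \<le> (\<integral>y. killed_value {B} \<rho> y \<partial>\<nu>)}"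

lemma gain:
  assumes B: "B \<noteq> {}" "B \<subseteq> A"
  shows gain_upper: "0 \<le> (\<integral>y. killed_value {B} \<rho> y \<partial>\<nu>) \<Longrightarrow> \<rho> \<le> gain B"
    and gain_nonneg: "0 \<le> gain B"
    and value_eq_gain: "z \<in> Z \<Longrightarrow> average_cost_value Z B \<eta> c z = ennreal (gain B)"
proof -
  let ?S = "{\<rho>. 0 \<le> (\<integral>y. killed_value {B} \<rho> y \<partial>\<nu>)}"
  obtain z0 where z0: "z0 \<in> Z" using Z_nonempty by auto
  \<comment> \<open>Every charge in the set is a lower bound for the value, which is finite.\<close>
  have bdd: "bdd_above ?S"
  proof (rule bdd_aboveI)
    fix \<rho> assume "\<rho> \<in> ?S"
    then have "ennreal \<rho> \<le> ennreal (radius 0 * w_mean)"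
      using value_ge_if_mean_nonneg[OF B order_refl z0] value_le_weight[OF B z0] by (auto intro: order_trans)
    then show "\<rho> \<le> radius 0 * w_mean" using radius_nonneg w_mean_nonneg by (simp add: ennreal_le_iff)
  qed
  show upper: "\<rho> \<le> gain B" if "0 \<le> (\<integral>y. killed_value {B} \<rho> y \<partial>\<nu>)" for \<rho>
    unfolding gain_def using that by (intro cSup_upper[OF _ bdd]) simp
  have S0: "0 \<in> ?S"
    using killed_value_nonneg[OF B] by (auto intro!: integral_nonneg_AE AE_I2 simp: lambda_space)
  show g0: "0 \<le> gain B" using upper S0 by simp
  show "average_cost_value Z B \<eta> c z = ennreal (gain B)" if z: "z \<in> Z"
  proof (rule antisym)
    have "average_cost_value Z B \<eta> c z \<le> ennreal (gain B + e)" if "0 < e" for e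
      using upper[of "gain B + e"] that by (intro value_le_if_mean_nonpos[OF B z]) force
    then have "eventually (\<lambda>e. average_cost_value Z B \<eta> c z \<le> ennreal (gain B + e)) (at_right 0)"
      by (auto simp: eventually_at_filter)
    moreover have "((\<lambda>e. ennreal (gain B + e)) \<longlongrightarrow> ennreal (gain B + 0)) (at_right 0)"
      by (intro tendsto_ennrealI tendsto_intros)
    ultimately show "average_cost_value Z B \<eta> c z \<le> ennreal (gain B)"
      by (intro tendsto_lowerbound[where F="at_right (0::real)"]) auto
    show "ennreal (gain B) \<le> average_cost_value Z B \<eta> c z"
    proof (rule ccontr)
      assume "\<not> ?thesis"
      then have less: "average_cost_value Z B \<eta> c z < ennreal (gain B)" by simp
      then obtain v where v: "average_cost_value Z B \<eta> c z = ennreal v" "0 \<le> v"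
        by (cases "average_cost_value Z B \<eta> c z") auto
      with less have "v < gain B" by (simp add: ennreal_less_iff)
      then obtain \<rho> where "\<rho> \<in> ?S" "v < \<rho>"
        unfolding gain_def using less_cSupD[of ?S v] S0 by blast
      with value_ge_if_mean_nonneg[OF B order_refl z, of \<rho>] v show False by (simp add: ennreal_le_iff2)
    qed
  qed
qed

section \<open>Convergence of the gains under quantization\<close>

lemma wfun_integral_limit:
  assumes u: "\<And>m. wfun K (u m)" and v: "wfun K v" and lim: "\<And>y. y \<in> Z \<Longrightarrow> (\<lambda>m. u m y) \<longlonglongrightarrow> v y"
  shows "x \<in> Z \<times> A \<Longrightarrow> (\<lambda>m. \<integral>y. u m y \<partial>\<eta> x) \<longlonglongrightarrow> (\<integral>y. v y \<partial>\<eta> x)"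
    and "(\<lambda>m. \<integral>y. u m y \<partial>\<nu>) \<longlonglongrightarrow> (\<integral>y. v y \<partial>\<nu>)"
proof -
  show "(\<lambda>m. \<integral>y. u m y \<partial>\<eta> x) \<longlonglongrightarrow> (\<integral>y. v y \<partial>\<eta> x)" if x: "x \<in> Z \<times> A"
  proof (rule integral_dominated_convergence[where w="\<lambda>y. K * w y"])
    show "v \<in> borel_measurable (\<eta> x)" "u m \<in> borel_measurable (\<eta> x)" for m
      using wfun_measurable[OF u] wfun_measurable[OF v] by (auto simp: measurable_cong_sets[OF eta_sets[OF x] refl])
    show "integrable (\<eta> x) (\<lambda>y. K * w y)" using wfun_integrable(1)[OF wfun_w x] by simp
    show "AE y in \<eta> x. (\<lambda>m. u m y) \<longlonglongrightarrow> v y" using lim by (intro AE_I2) (simp add: eta_space[OF x])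
    show "AE y in \<eta> x. norm (u m y) \<le> K * w y" for m
      using wfun_le[OF u] by (intro AE_I2) (simp add: eta_space[OF x])
  qed
  show "(\<lambda>m. \<integral>y. u m y \<partial>\<nu>) \<longlonglongrightarrow> (\<integral>y. v y \<partial>\<nu>)"
  proof (rule integral_dominated_convergence[where w="\<lambda>y. K * w y"])
    show "v \<in> borel_measurable \<nu>" "u m \<in> borel_measurable \<nu>" for m
      using wfun_measurable[OF u] wfun_measurable[OF v] by (auto simp: measurable_cong_sets[OF lambda_sets refl])
    show "integrable \<nu> (\<lambda>y. K * w y)" using w_lambda_integrable by simp
    show "AE y in \<nu>. (\<lambda>m. u m y) \<longlonglongrightarrow> v y" using lim by (intro AE_I2) (simp add: lambda_space)
    show "AE y in \<nu>. norm (u m y) \<le> K * w y" for m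
      using wfun_le[OF u] by (intro AE_I2) (simp add: lambda_space)
  qed
qed

context
  fixes \<Lambda> :: "nat \<Rightarrow> 'a set"
  assumes Lambda: "\<And>n. 1 \<le> n \<Longrightarrow> \<Lambda> n \<noteq> {}" "\<And>n. 1 \<le> n \<Longrightarrow> \<Lambda> n \<subseteq> A"
    and dense: "\<And>a d. a \<in> A \<Longrightarrow> 0 < d \<Longrightarrow> eventually (\<lambda>n. \<exists>b\<in>\<Lambda> n. dist b a < d) sequentially"
begin

text \<open>The game family for the limit: the adversary is denied the first, coarse quantizations.
The family shrinks as \<open>m\<close> grows, which is where the monotonicity comes from.\<close>

definition tail :: "nat \<Rightarrow> 'a set set" where "tail m = \<Lambda> ` {m<..}"

lemma action_family_tail: "action_family (tail m)"
  using Lambda by (auto simp: action_family_def tail_def)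

lemma action_family_A: "action_family {A}"
  using A_nonempty by (auto simp: action_family_def)

lemma tail_refines: "\<exists>B'\<in>tail m. B' \<subseteq> A"
  using Lambda(2)[of "Suc m"] by (auto simp: tail_def)

text \<open>In the induction step, an almost optimal action \<open>a\<close> for the limit problem is fixed first. Dominated convergence at this
single action yields an index \<open>m0\<close> after which it is almost optimal for the game; the continuity of the \<open>Q\<close>-function of
that one index \<open>m0\<close> allows \<open>a\<close> to be replaced by a nearby point of \<open>\<Lambda> n\<close>, and monotonicity in \<open>m\<close> carries
the estimate to all later indices.\<close>

lemma iterate_tail_limit:
  assumes "z \<in> Z"
  shows "(\<lambda>m. iterate (tail m) \<rho> k z) \<longlonglongrightarrow> iterate {A} \<rho> k z"
  using assms
proof (induction k arbitrary: z)
  case 0 then show ?case by (simp add: iterate_simps)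
next
  case (Suc k)
  note z = \<open>z \<in> Z\<close>
  let ?u = "\<lambda>m. iterate (tail m) \<rho> k" and ?v = "iterate {A} \<rho> k"
  let ?b = "iterate {A} \<rho> (Suc k) z"
  note wu = wfun_iterate[OF action_family_tail, of \<rho> _ k]
  note wv = wfun_iterate[OF action_family_A, of \<rho> k]
  have lower: "?b \<le> iterate (tail m) \<rho> (Suc k) z" for m
    by (rule iterate_mono[OF action_family_A action_family_tail _ z]) (use tail_refines in auto)
  have upper: "eventually (\<lambda>m. iterate (tail m) \<rho> (Suc k) z < ?b + e) sequentially" if "0 < e" for e
  proof -
    have "(INF a\<in>A. Q \<rho> ?v (z, a)) < ?b + e / 4"
      using \<open>0 < e\<close> by (simp add: iterate_simps bellman_def minimax_def)
    then obtain a where a: "a \<in> A" "Q \<rho> ?v (z, a) < ?b + e / 4"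
      using cInf_lessD[of "(\<lambda>a. Q \<rho> ?v (z, a)) ` A"] A_nonempty by auto
    have "(\<lambda>m. Q \<rho> (?u m) (z, a)) \<longlonglongrightarrow> Q \<rho> ?v (z, a)"
      unfolding Q_def using z a by (intro tendsto_intros wfun_integral_limit[OF wu wv Suc.IH]) auto
    then have "eventually (\<lambda>m. Q \<rho> (?u m) (z, a) < Q \<rho> ?v (z, a) + e / 4) sequentially"
      using \<open>0 < e\<close> by (intro order_tendstoD(2)) auto
    then obtain m0 where m0: "Q \<rho> (?u m0) (z, a) < Q \<rho> ?v (z, a) + e / 4"
      by (auto simp: eventually_sequentially)
    have "continuous_on A (\<lambda>a. Q \<rho> (?u m0) (z, a))"
      using z by (intro continuous_on_compose2[OF Q_continuous[OF wu]] continuous_intros) auto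
    then obtain d where d: "0 < d"
      "\<And>b. b \<in> A \<Longrightarrow> dist b a < d \<Longrightarrow> dist (Q \<rho> (?u m0) (z, b)) (Q \<rho> (?u m0) (z, a)) < e / 4"
      unfolding continuous_on_iff using a(1) \<open>0 < e\<close> by (metis zero_less_divide_iff zero_less_numeral)
    obtain n0 where n0: "\<And>n. n \<ge> n0 \<Longrightarrow> \<exists>b\<in>\<Lambda> n. dist b a < d"
      using dense[OF a(1) d(1)] by (auto simp: eventually_sequentially)
    have "iterate (tail m) \<rho> (Suc k) z \<le> ?b + 3 * e / 4" if m: "m \<ge> max m0 n0" for m
      unfolding iterate_simps(2)[of "tail m"] bellman_def minimax_def
    proof (rule cSUP_least[OF action_familyD(1)[OF action_family_tail]])
      fix B assume B: "B \<in> tail m"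
      then obtain n where n: "B = \<Lambda> n" "n > m" by (auto simp: tail_def)
      then obtain b where b: "b \<in> B" "dist b a < d" using n0[of n] m by auto
      note B' = action_familyD(2)[OF action_family_tail B]
      have bA: "b \<in> A" using b B' by auto
      have "bdd_below ((\<lambda>a. Q \<rho> (?u m) (z, a)) ` B)"
        by (rule abs_INF_le(1)) (use B' Q_bound[OF wu z] in auto)
      then have "(INF a\<in>B. Q \<rho> (?u m) (z, a)) \<le> Q \<rho> (?u m) (z, b)" by (rule cINF_lower[OF _ b(1)])
      also have "\<dots> \<le> Q \<rho> (?u m0) (z, b) + \<alpha> * 0 * w z"
      proof (rule Q_mono[OF wu wu z bA])
        fix y assume y: "y \<in> Z"
        have "?u m y \<le> ?u m0 y"
          by (rule iterate_mono[OF action_family_tail action_family_tail _ y]) (use m in \<open>auto simp: tail_def\<close>)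
        then show "?u m y \<le> ?u m0 y + 0 * w y" by simp
      qed simp
      also have "\<dots> \<le> ?b + 3 * e / 4"
        using d(2)[OF bA b(2)] m0 a(2) unfolding dist_real_def by linarith
      finally show "(INF a\<in>B. Q \<rho> (?u m) (z, a)) \<le> ?b + 3 * e / 4" .
    qed
    then show ?thesis
      using eventually_ge_at_top[of "max m0 n0"] \<open>0 < e\<close>
      by (rule_tac eventually_mono[OF eventually_ge_at_top[of "max m0 n0"]]) fastforce
  qed
  show ?case
  proof (rule tendstoI)
    fix e :: real assume "0 < e"
    from upper[OF this]
    show "eventually (\<lambda>m. dist (iterate (tail m) \<rho> (Suc k) z) ?b < e) sequentially"
    proof eventually_elim
      case (elim m) then show ?case using lower[of m] by (simp add: dist_real_def)
    qed
  qed
qed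

lemma killed_value_tail_limit:
  assumes z: "z \<in> Z"
  shows "(\<lambda>m. killed_value (tail m) \<rho> z) \<longlonglongrightarrow> killed_value {A} \<rho> z"
proof (rule tendstoI)
  fix e :: real assume "0 < e"
  then have "eventually (\<lambda>k. \<alpha> ^ k * (radius \<rho> * w z) < e / 3) sequentially"
    by (intro order_tendstoD[OF geometric_vanishes]) simp
  then obtain k where k: "\<alpha> ^ k * radius \<rho> * w z < e / 3"
    by (auto simp: eventually_sequentially mult.assoc)
  have "eventually (\<lambda>m. dist (iterate (tail m) \<rho> k z) (iterate {A} \<rho> k z) < e / 3) sequentially"
    using \<open>0 < e\<close> by (intro tendstoD[OF iterate_tail_limit[OF z]]) simp
  then show "eventually (\<lambda>m. dist (killed_value (tail m) \<rho> z) (killed_value {A} \<rho> z) < e) sequentially"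
  proof eventually_elim
    case (elim m)
    then show ?case
      using k killed_value_diff[OF action_family_tail z, of m \<rho> k] killed_value_diff[OF action_family_A z, of \<rho> k]
      unfolding dist_real_def by linarith
  qed
qed

lemma gain_le_gain_quantized:
  assumes "1 \<le> n" shows "gain A \<le> gain (\<Lambda> n)"
proof -
  obtain z where z: "z \<in> Z" using Z_nonempty by auto
  note B = Lambda(1)[OF assms] Lambda(2)[OF assms]
  have "0 \<in> {\<rho>. 0 \<le> (\<integral>y. killed_value {A} \<rho> y \<partial>\<nu>)}"
    using killed_value_nonneg[OF A_nonempty order_refl] by (auto intro!: integral_nonneg_AE AE_I2 simp: lambda_space)
  then show ?thesis
    unfolding gain_def[of A]
  proof (rule_tac cSup_least)
    fix \<rho> assume "\<rho> \<in> {\<rho>. 0 \<le> (\<integral>y. killed_value {A} \<rho> y \<partial>\<nu>)}"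
    then have "ennreal \<rho> \<le> average_cost_value Z (\<Lambda> n) \<eta> c z"
      by (intro value_ge_if_mean_nonneg[OF A_nonempty order_refl B(2) z]) simp
    then show "\<rho> \<le> gain (\<Lambda> n)"
      using gain_nonneg[OF B] by (simp add: value_eq_gain[OF B z] ennreal_le_iff)
  qed auto
qed

text \<open>For a charge slightly above \<open>gain A\<close> the mean killed cost is negative for \<open>A\<close>, hence for the game with large \<open>m\<close>,
hence for each \<open>\<Lambda> n\<close> with \<open>n > m\<close>, since the adversary of the game may always choose \<open>\<Lambda> n\<close>.\<close>

lemma gain_quantized_limit: "(\<lambda>n. gain (\<Lambda> n)) \<longlonglongrightarrow> gain A"
proof (rule tendstoI)
  fix e :: real assume "0 < e"
  obtain z where z: "z \<in> Z" using Z_nonempty by auto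
  define \<rho> where "\<rho> = gain A + e / 2"
  have \<rho>0: "0 \<le> \<rho>" using gain_nonneg[OF A_nonempty order_refl] \<open>0 < e\<close> by (simp add: \<rho>_def)
  have "(\<integral>y. killed_value {A} \<rho> y \<partial>\<nu>) < 0"
    using gain_upper[OF A_nonempty order_refl, of \<rho>] \<open>0 < e\<close> by (force simp: \<rho>_def)
  moreover have "(\<lambda>m. \<integral>y. killed_value (tail m) \<rho> y \<partial>\<nu>) \<longlonglongrightarrow> (\<integral>y. killed_value {A} \<rho> y \<partial>\<nu>)"
    by (rule wfun_integral_limit(2)[OF wfun_killed_value[OF action_family_tail]
          wfun_killed_value[OF action_family_A] killed_value_tail_limit])
  ultimately have "eventually (\<lambda>m. (\<integral>y. killed_value (tail m) \<rho> y \<partial>\<nu>) < 0) sequentially"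
    by (rule order_tendstoD(2)[rotated])
  then obtain m where m: "(\<integral>y. killed_value (tail m) \<rho> y \<partial>\<nu>) < 0"
    by (auto simp: eventually_sequentially)
  have upper: "gain (\<Lambda> n) \<le> \<rho>" if "n > m" for n
  proof -
    have B: "\<Lambda> n \<noteq> {}" "\<Lambda> n \<subseteq> A" using that Lambda[of n] by auto
    note F = action_family_singleton[OF B]
    have "(\<integral>y. killed_value {\<Lambda> n} \<rho> y \<partial>\<nu>) \<le> (\<integral>y. killed_value (tail m) \<rho> y \<partial>\<nu>)"
    proof (rule integral_mono)
      show "integrable \<nu> (killed_value {\<Lambda> n} \<rho>)" "integrable \<nu> (killed_value (tail m) \<rho>)"
        using wfun_integrable(2)[OF wfun_killed_value] F action_family_tail by auto
      fix y assume "y \<in> space \<nu>"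
      then show "killed_value {\<Lambda> n} \<rho> y \<le> killed_value (tail m) \<rho> y"
        using that by (intro killed_value_mono[OF F action_family_tail]) (auto simp: lambda_space tail_def)
    qed
    then have "average_cost_value Z (\<Lambda> n) \<eta> c z \<le> ennreal \<rho>"
      using m by (intro value_le_if_mean_nonpos[OF B z]) simp
    then show ?thesis using \<rho>0 by (simp add: value_eq_gain[OF B z] ennreal_le_iff)
  qed
  show "eventually (\<lambda>n. dist (gain (\<Lambda> n)) (gain A) < e) sequentially"
    using eventually_gt_at_top[of m]
  proof eventually_elim
    case (elim n)
    then show ?case
      using upper[of n] gain_le_gain_quantized[of n] \<open>0 < e\<close> by (simp add: dist_real_def \<rho>_def)
  qed
qed

end

end

theorem theorem4p2:
  fixes Z :: "'z::polish_space set"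
    and A :: "'a::polish_space set"
    and \<eta> :: "'z \<times> 'a \<Rightarrow> 'z measure"
    and c :: "'z \<times> 'a \<Rightarrow> real"
    and M \<alpha> :: real
    and w :: "'z \<Rightarrow> real"
    and \<nu> :: "'z measure"
    and \<phi> :: "'z \<times> 'a \<Rightarrow> real"
    and \<Lambda> :: "nat \<Rightarrow> 'a set"
  assumes Z_borel: "Z \<in> sets borel"
    and A_nonempty: "A \<noteq> {}"
    and kernel: "\<eta> \<in> borel_on Z \<Otimes>\<^sub>M borel_on A \<rightarrow>\<^sub>M prob_algebra (borel_on Z)"
    and c_nonneg: "\<And>z a. z \<in> Z \<Longrightarrow> a \<in> A \<Longrightarrow> 0 \<le> c (z, a)"
    and c_cont: "continuous_on (Z \<times> A) c"
    and weak_cont: "weakly_continuous_kernel Z A \<eta>"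
    and A_compact: "compact A"
    and M_nonneg: "0 \<le> M"
    and w_ge_1: "\<And>z. z \<in> Z \<Longrightarrow> 1 \<le> w z"
    and w_cont: "continuous_on Z w"
    and c_bound: "\<And>z. z \<in> Z \<Longrightarrow> (SUP a\<in>A. c (z, a)) \<le> M * w z"
    and w_integrable: "\<And>z a. z \<in> Z \<Longrightarrow> a \<in> A \<Longrightarrow> integrable (\<eta> (z, a)) w"
    and w_int_cont: "continuous_on (Z \<times> A) (\<lambda>x. \<integral>y. w y \<partial>\<eta> x)"
    and lambda_prob: "prob_space \<nu>" "sets \<nu> = sets (borel_on Z)"
    and phi_nonneg: "\<And>z a. z \<in> Z \<Longrightarrow> a \<in> A \<Longrightarrow> 0 \<le> \<phi> (z, a)"
    and phi_cont: "continuous_on (Z \<times> A) \<phi>"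
    and alpha: "0 < \<alpha>" "\<alpha> < 1"
    and drift: "\<And>z a. z \<in> Z \<Longrightarrow> a \<in> A \<Longrightarrow>
        (\<integral>y. w y \<partial>\<eta> (z, a)) \<le> \<alpha> * w z + (\<integral>y. w y \<partial>\<nu>) * \<phi> (z, a)"
    and minorization: "\<And>z a D. z \<in> Z \<Longrightarrow> a \<in> A \<Longrightarrow> D \<in> sets (borel_on Z) \<Longrightarrow>
        measure \<nu> D * \<phi> (z, a) \<le> measure (\<eta> (z, a)) D"
    and w_lambda_integrable: "integrable \<nu> w"
    and phi_pos: "\<And>f. f \<in> borel_on Z \<rightarrow>\<^sub>M borel_on A \<Longrightarrow> 0 < (\<integral>z. \<phi> (z, f z) \<partial>\<nu>)"
    and Lambda: "\<And>n. 1 \<le> n \<Longrightarrow> finite (\<Lambda> n)" "\<And>n. 1 \<le> n \<Longrightarrow> \<Lambda> n \<noteq> {}"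
      "\<And>n. 1 \<le> n \<Longrightarrow> \<Lambda> n \<subseteq> A"
    and Lambda_net: "\<And>n a. 1 \<le> n \<Longrightarrow> a \<in> A \<Longrightarrow> (MIN b\<in>\<Lambda> n. dist a b) < 1 / real n"
  shows "\<exists>(v::nat \<Rightarrow> real) (v_opt::real).
      (\<forall>n\<ge>1. 0 \<le> v n \<and> (\<forall>z\<in>Z. average_cost_value Z (\<Lambda> n) \<eta> c z = ennreal (v n))) \<and>
      0 \<le> v_opt \<and> (\<forall>z\<in>Z. average_cost_value Z A \<eta> c z = ennreal v_opt) \<and>
      (\<lambda>n. \<bar>v n - v_opt\<bar>) \<longlonglongrightarrow> 0"
proof -
  \<comment> \<open>A supremum in the reals bounds its members only for bounded sets; here compactness provides the bound.\<close>
  have c_le: "c (z, a) \<le> M * w z" if z: "z \<in> Z" and a: "a \<in> A" for z a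
  proof -
    have "continuous_on A (\<lambda>a. c (z, a))"
      using z by (intro continuous_on_compose2[OF c_cont] continuous_intros) auto
    then have "bdd_above ((\<lambda>a. c (z, a)) ` A)"
      by (intro bounded_imp_bdd_above compact_imp_bounded compact_continuous_image A_compact)
    from cSUP_upper[OF a this] c_bound[OF z] show ?thesis by linarith
  qed
  interpret weighted_mdp Z A \<eta> c M \<alpha> w \<nu> \<phi>
    by (rule weighted_mdp.intro)
       (fact A_nonempty kernel c_nonneg c_cont weak_cont A_compact M_nonneg w_ge_1 w_cont c_le w_integrable
         w_int_cont lambda_prob phi_nonneg phi_cont alpha drift minorization w_lambda_integrable)+
  have dense: "eventually (\<lambda>n. \<exists>b\<in>\<Lambda> n. dist b a < d) sequentially" if a: "a \<in> A" and d: "0 < d" for a and d :: real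
  proof -
    obtain N where N: "1 / real (Suc N) < d"
      using reals_Archimedean[OF d] by (auto simp: inverse_eq_divide)
    show ?thesis
      using eventually_ge_at_top[of "Suc N"]
    proof eventually_elim
      case (elim n)
      then have n: "1 \<le> n" by simp
      have "(MIN b\<in>\<Lambda> n. dist a b) \<in> (\<lambda>b. dist a b) ` \<Lambda> n"
        using Lambda(1,2)[OF n] by (intro Min_in) auto
      then obtain b where b: "b \<in> \<Lambda> n" "(MIN b\<in>\<Lambda> n. dist a b) = dist a b" by auto
      have "1 / real n \<le> 1 / real (Suc N)" using elim by (intro divide_left_mono) auto
      then have "dist b a < d" using Lambda_net[OF n a] b N by (simp add: dist_commute)
      then show ?case using b by auto
    qed
  qed
  have "(\<lambda>n. \<bar>gain (\<Lambda> n) - gain A\<bar>) \<longlonglongrightarrow> 0"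
    using gain_quantized_limit[OF Lambda(2,3) dense] by (intro tendsto_rabs_zero LIM_zero)
  then show ?thesis
    using gain_nonneg value_eq_gain Lambda(2,3) A_nonempty
    by (intro exI[of _ "\<lambda>n. gain (\<Lambda> n)"] exI[of _ "gain A"]) auto
qed

end
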